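(* For each $k\geq 2$, there is a finite-rank free abelian group $A_k$ with an $(\mathrm{Aut}\,\pi)$-action, an injective, $(\mathrm{Aut}\,\pi)$-equivariant homomorphism $\eta\colon \mathrm{Hom}(H,\mathcal{L}_{k+1})\to A_k$ (the domain being the target group of $\delta_k$), and a crossed homomorphism $\gamma_k\colon \mathrm{Aut}\,\pi\to A_k$ such that $\gamma_k$ extends $\eta\circ\delta_k$, i.e. $\gamma_k|_{\mathcal{A}_n(k)}=\eta\circ\delta_k$.
   Context: Let $\pi$ be a nonabelian free group of finite rank $n$, $H=H_1(\pi)=\pi/[\pi,\pi]$. Lower central series: $\pi_{(0)}=\pi$, $\pi_{(k+1)}=[\pi,\pi_{(k)}]$. Set $\Gamma_k=\pi/\pi_{(k-1)}$ for $k\ge1$ and $\mathcal{L}_{k+1}=\pi_{(k-1)}/\pi_{(k)}$, an abelian group. $\mathrm{Aut}\,\pi$ acts on $H$, $\Gamma_k$, $\mathcal{L}_{k+1}$, and on $\mathrm{Hom}(H,\mathcal{L}_{k+1})$ by $(\alpha\cdot f)(c)=\alpha\cdot f(\alpha^{-1}\cdot c)$. The $k$th Andreadakis group $\mathcal{A}_n(k)$ is the kernel of the action of $\mathrm{Aut}\,\pi$ on $\Gamma_k$. The $k$th free-group Johnson homomorphism is $\delta_k\colon\mathcal{A}_n(k)\to\mathrm{Hom}(H,\mathcal{L}_{k+1})$, $\delta_k(\alpha)([u])=(\alpha(u)u^{-1})\cdot\pi_{(k)}$ for $u\in\pi$. A crossed homomorphism $f\colon G\to A$ to a $G$-module satisfies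 $f(gh)=g\cdot f(h)+f(g)$. *)

theory Defs
  imports "HOL-Algebra.Bij" "HOL-Algebra.Generated_Groups" "HOL-Algebra.Free_Abelian_Groups"
begin

section \<open>Free groups of finite rank\<close>

text \<open>A letter \<open>(s, True)\<close> stands for \<open>s\<close>, a letter \<open>(s, False)\<close> for the inverse of \<open>s\<close>.\<close>

definition word_val :: "('a, 'b) monoid_scheme \<Rightarrow> ('a \<times> bool) list \<Rightarrow> 'a" where
  "word_val G w = foldr (\<lambda>(s, b) x. (if b then s else inv\<^bsub>G\<^esub> s) \<otimes>\<^bsub>G\<^esub> x) w \<one>\<^bsub>G\<^esub>"

definition reduced_words :: "'a set \<Rightarrow> ('a \<times> bool) list set" where
  "reduced_words S =
    {w. fst ` set w \<subseteq> S \<and> successively (\<lambda>(s, b) (t, c). s = t \<longrightarrow> b = c) w}"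

text \<open>\<open>S\<close> is a free basis of \<open>G\<close>: every element of \<open>G\<close> is the value of exactly one reduced word
  over \<open>S\<close>.\<close>

definition free_basis :: "('a, 'b) monoid_scheme \<Rightarrow> 'a set \<Rightarrow> bool" where
  "free_basis G S \<longleftrightarrow>
    group G \<and> S \<subseteq> carrier G \<and> bij_betw (word_val G) (reduced_words S) (carrier G)"

definition free_group_of_rank :: "('a, 'b) monoid_scheme \<Rightarrow> nat \<Rightarrow> bool" where
  "free_group_of_rank G n \<longleftrightarrow> (\<exists>S. free_basis G S \<and> finite S \<and> card S = n)"

section \<open>The lower central series and its quotients\<close>

definition commutator_subgroup ::
    "('a, 'b) monoid_scheme \<Rightarrow> 'a set \<Rightarrow> 'a set \<Rightarrow> 'a set" where
  "commutator_subgroup G A B =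
    generate G (\<Union>a\<in>A. \<Union>b\<in>B. {a \<otimes>\<^bsub>G\<^esub> b \<otimes>\<^bsub>G\<^esub> inv\<^bsub>G\<^esub> a \<otimes>\<^bsub>G\<^esub> inv\<^bsub>G\<^esub> b})"

text \<open>The numbering starts at \<open>0\<close> with the whole group.\<close>

primrec lower_central :: "('a, 'b) monoid_scheme \<Rightarrow> nat \<Rightarrow> 'a set" where
  "lower_central G 0 = carrier G"
| "lower_central G (Suc k) = commutator_subgroup G (carrier G) (lower_central G k)"

declare lower_central.simps(2) [simp del]

definition abelianization :: "('a, 'b) monoid_scheme \<Rightarrow> 'a set monoid" where
  "abelianization G = G Mod derived G (carrier G)"

text \<open>\<open>nilpotent_quotient G k\<close> is the group $\Gamma_k$, used for \<open>k \<ge> 1\<close>.\<close>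

definition nilpotent_quotient :: "('a, 'b) monoid_scheme \<Rightarrow> nat \<Rightarrow> 'a set monoid" where
  "nilpotent_quotient G k = G Mod lower_central G (k - 1)"

text \<open>\<open>lower_central_quotient G m\<close> is the abelian group $\mathcal{L}_m$, used for \<open>m \<ge> 2\<close>: the
  quotient of the term number \<open>m - 2\<close> of the series by the next term, number \<open>m - 1\<close>.\<close>

definition lower_central_quotient :: "('a, 'b) monoid_scheme \<Rightarrow> nat \<Rightarrow> 'a set monoid" where
  "lower_central_quotient G m =
    (G\<lparr>carrier := lower_central G (m - 2)\<rparr>) Mod lower_central G (m - 1)"

section \<open>Actions of the automorphism group\<close>

text \<open>An automorphism acts on a quotient \<open>Q\<close>, whose elements are cosets of a
  characteristic subgroup, by taking the coset of \<open>x\<close> to the coset of \<open>\<alpha> x\<close>,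
  i.e. by taking images of cosets.\<close>

definition coset_act :: "'a set monoid \<Rightarrow> ('a \<Rightarrow> 'a) \<Rightarrow> 'a set \<Rightarrow> 'a set" where
  "coset_act Q \<alpha> = (\<lambda>X\<in>carrier Q. \<alpha> ` X)"

text \<open>Homomorphisms in \<open>hom G H\<close> are unconstrained outside \<open>carrier G\<close>; restricting to
  extensional functions gives one element for each homomorphism.\<close>

definition hom_group :: "('a, 'c) monoid_scheme \<Rightarrow> ('b, 'd) monoid_scheme \<Rightarrow> ('a \<Rightarrow> 'b) monoid" where
  "hom_group G H =
    \<lparr>carrier = hom G H \<inter> extensional (carrier G),
     mult = \<lambda>f g. \<lambda>x\<in>carrier G. f x \<otimes>\<^bsub>H\<^esub> g x,
     one = \<lambda>x\<in>carrier G. \<one>\<^bsub>H\<^esub>\<rparr>"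

definition johnson_target :: "('a, 'b) monoid_scheme \<Rightarrow> nat \<Rightarrow> ('a set \<Rightarrow> 'a set) monoid" where
  "johnson_target G k = hom_group (abelianization G) (lower_central_quotient G (k + 1))"

definition johnson_target_act ::
    "('a, 'b) monoid_scheme \<Rightarrow> nat \<Rightarrow> ('a \<Rightarrow> 'a) \<Rightarrow> ('a set \<Rightarrow> 'a set) \<Rightarrow> ('a set \<Rightarrow> 'a set)" where
  "johnson_target_act G k \<alpha> f =
    (\<lambda>c\<in>carrier (abelianization G).
      coset_act (lower_central_quotient G (k + 1)) \<alpha>
        (f (coset_act (abelianization G) (inv\<^bsub>AutoGroup G\<^esub> \<alpha>) c)))"

definition andreadakis :: "('a, 'b) monoid_scheme \<Rightarrow> nat \<Rightarrow> ('a \<Rightarrow> 'a) set" where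
  "andreadakis G k =
    kernel (AutoGroup G) (AutoGroup (nilpotent_quotient G k)) (coset_act (nilpotent_quotient G k))"

text \<open>The value at a class \<open>c\<close> is the common coset of all \<open>\<alpha> u \<otimes> inv u\<close> with
  \<open>u \<in> c\<close>; see \<open>johnson_coset\<close> below.\<close>

definition johnson :: "('a, 'b) monoid_scheme \<Rightarrow> nat \<Rightarrow> ('a \<Rightarrow> 'a) \<Rightarrow> 'a set \<Rightarrow> 'a set" where
  "johnson G k \<alpha> =
    (\<lambda>c\<in>carrier (abelianization G).
      the_elem ((\<lambda>u. lower_central G k #>\<^bsub>G\<^esub> (\<alpha> u \<otimes>\<^bsub>G\<^esub> inv\<^bsub>G\<^esub> u)) ` c))"

section \<open>Modules and crossed homomorphisms\<close>

definition finite_rank_free_abelian :: "('a, 'b) monoid_scheme \<Rightarrow> bool" where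
  "finite_rank_free_abelian A \<longleftrightarrow>
    comm_group A \<and> (\<exists>m::nat. A \<cong> free_Abelian_group {..<m})"

definition module_action ::
    "('g, 'c) monoid_scheme \<Rightarrow> ('a, 'b) monoid_scheme \<Rightarrow> ('g \<Rightarrow> 'a \<Rightarrow> 'a) \<Rightarrow> bool" where
  "module_action G A \<phi> \<longleftrightarrow> \<phi> \<in> hom G (AutoGroup A)"

definition crossed_hom ::
    "('g, 'c) monoid_scheme \<Rightarrow> ('a, 'b) monoid_scheme \<Rightarrow> ('g \<Rightarrow> 'a \<Rightarrow> 'a) \<Rightarrow> ('g \<Rightarrow> 'a) \<Rightarrow> bool" where
  "crossed_hom G A \<phi> f \<longleftrightarrow>
    f \<in> carrier G \<rightarrow> carrier A \<and>
    (\<forall>g\<in>carrier G. \<forall>h\<in>carrier G. f (g \<otimes>\<^bsub>G\<^esub> h) = \<phi> g (f h) \<otimes>\<^bsub>A\<^esub> f g)"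

section \<open>Basic properties\<close>

context group
begin

lemma lower_central_normal: "lower_central G k \<lhd> G"
proof (induction k)
  case 0
  then show ?case by (simp add: normal_self)
next
  case (Suc k)
  interpret N: normal "lower_central G k" G by fact
  show ?case
    unfolding lower_central.simps commutator_subgroup_def
  proof (rule normal_generateI)
    show "(\<Union>a\<in>carrier G. \<Union>b\<in>lower_central G k. {a \<otimes> b \<otimes> inv a \<otimes> inv b}) \<subseteq> carrier G"
      using N.subset by blast
  next
    fix h g assume h: "h \<in> (\<Union>a\<in>carrier G. \<Union>b\<in>lower_central G k. {a \<otimes> b \<otimes> inv a \<otimes> inv b})"
      and g: "g \<in> carrier G"
    then obtain a b where ab: "a \<in> carrier G" "b \<in> lower_central G k"
      and h: "h = a \<otimes> b \<otimes> inv a \<otimes> inv b" by blast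
    have b: "b \<in> carrier G" using ab N.subset by blast
    have *: "x \<otimes> (inv g \<otimes> (g \<otimes> y)) = x \<otimes> y" if "x \<in> carrier G" "y \<in> carrier G" for x y
      using that g by (simp flip: m_assoc)
    have "g \<otimes> h \<otimes> inv g = (g \<otimes> a \<otimes> inv g) \<otimes> (g \<otimes> b \<otimes> inv g) \<otimes> inv (g \<otimes> a \<otimes> inv g) \<otimes> inv (g \<otimes> b \<otimes> inv g)"
      using ab(1) b g by (simp add: h m_assoc inv_mult_group *)
    moreover have "g \<otimes> b \<otimes> inv g \<in> lower_central G k" using ab g by (simp add: N.inv_op_closed2)
    moreover have "g \<otimes> a \<otimes> inv g \<in> carrier G" using ab g by simp
    ultimately show "g \<otimes> h \<otimes> inv g \<in> (\<Union>a\<in>carrier G. \<Union>b\<in>lower_central G k. {a \<otimes> b \<otimes> inv a \<otimes> inv b})"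
      by (intro UN_I[of "g \<otimes> a \<otimes> inv g"] UN_I[of "g \<otimes> b \<otimes> inv g"]) simp_all
  qed
qed

lemma lower_central_subgroup: "subgroup (lower_central G k) G"
  using lower_central_normal by (rule normal_imp_subgroup)

lemma commutator_in_lower_central:
  "\<lbrakk>a \<in> carrier G; b \<in> lower_central G k\<rbrakk> \<Longrightarrow> a \<otimes> b \<otimes> inv a \<otimes> inv b \<in> lower_central G (Suc k)"
  by (auto simp: lower_central.simps(2) commutator_subgroup_def intro!: generate.incl)

lemma lower_central_Suc_subset: "lower_central G (Suc k) \<subseteq> lower_central G k"
proof -
  interpret N: normal "lower_central G k" G by (rule lower_central_normal)
  have "a \<otimes> b \<otimes> inv a \<otimes> inv b \<in> lower_central G k"
    if "a \<in> carrier G" "b \<in> lower_central G k" for a b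
    using that by (intro N.m_closed N.inv_op_closed2 N.m_inv_closed)
  then show ?thesis unfolding lower_central.simps commutator_subgroup_def
    by (intro generate_subgroup_incl[OF _ lower_central_subgroup] UN_least) simp
qed

lemma auto_group_hom: "\<alpha> \<in> auto G \<Longrightarrow> group_hom G G \<alpha>"
  by (simp add: auto_def group_hom_def group_hom_axioms_def is_group)

lemma auto_image: "\<alpha> \<in> auto G \<Longrightarrow> \<alpha> ` carrier G = carrier G"
  by (simp add: auto_def Bij_def bij_betw_def)

lemma auto_lower_central:
  assumes "\<alpha> \<in> auto G"
  shows "\<alpha> ` lower_central G k = lower_central G k"
proof (induction k)
  case 0
  then show ?case using assms by (simp add: auto_image)
next
  case (Suc k)
  interpret h: group_hom G G \<alpha> using assms by (rule auto_group_hom)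
  let ?f = "\<lambda>a b. a \<otimes> b \<otimes> inv a \<otimes> inv b"
  note sub = subgroup.subset[OF lower_central_subgroup[of k]]
  have "\<alpha> ` (\<Union>a\<in>carrier G. \<Union>b\<in>lower_central G k. {?f a b}) 
    = (\<Union>a\<in>carrier G. \<Union>b\<in>lower_central G k. {?f (\<alpha> a) (\<alpha> b)})"
    using sub by (simp add: image_UN subset_iff)
  also have "\<dots> = (\<Union>a\<in>\<alpha> ` carrier G. \<Union>b\<in>\<alpha> ` lower_central G k. {?f a b})"
    by simp
  also have "\<dots> = (\<Union>a\<in>carrier G. \<Union>b\<in>lower_central G k. {?f a b})"
    using Suc assms by (simp only: auto_image)
  finally show ?case
    unfolding lower_central.simps commutator_subgroup_def
    using h.generate_img[of "\<Union>a\<in>carrier G. \<Union>b\<in>lower_central G k. {?f a b}"] sub by force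
qed

lemma auto_rcos:
  assumes "\<alpha> \<in> auto G" "\<alpha> ` N = N" "N \<subseteq> carrier G" "x \<in> carrier G"
  shows "\<alpha> ` (N #> x) = N #> \<alpha> x"
proof -
  interpret h: group_hom G G \<alpha> using assms by (simp add: auto_group_hom)
  have "\<alpha> ` (N #> x) = (\<Union>n\<in>\<alpha> ` N. {n \<otimes> \<alpha> x})"
    using assms(3,4) by (simp add: r_coset_def image_UN subset_iff)
  then show ?thesis by (simp only: r_coset_def assms(2))
qed

lemma derived_eq: "derived G (carrier G) = lower_central G 1"
  by (simp add: derived_def lower_central.simps commutator_subgroup_def)

lemma coset_act_nilpotent_quotient:
  assumes "\<alpha> \<in> auto G" "x \<in> carrier G"
  shows "coset_act (nilpotent_quotient G k) \<alpha> (lower_central G (k - 1) #> x)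
    = lower_central G (k - 1) #> \<alpha> x"
  using assms rcosetsI[OF subgroup.subset[OF lower_central_subgroup[of "k-1"]]]
  by (simp add: coset_act_def nilpotent_quotient_def FactGroup_def auto_rcos auto_lower_central
      subgroup.subset lower_central_subgroup)

lemma coset_act_abelianization:
  assumes "\<alpha> \<in> auto G" "x \<in> carrier G"
  shows "coset_act (abelianization G) \<alpha> (derived G (carrier G) #> x) = derived G (carrier G) #> \<alpha> x"
  using coset_act_nilpotent_quotient[OF assms, of 2]
  by (simp add: nilpotent_quotient_def abelianization_def derived_eq)

lemma coset_act_lower_central_quotient:
  assumes "\<alpha> \<in> auto G" "x \<in> lower_central G (m - 2)"
  shows "coset_act (lower_central_quotient G m) \<alpha> (lower_central G (m - 1) #> x)
    = lower_central G (m - 1) #> \<alpha> x"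
proof -
  have "x \<in> carrier G" using assms(2) subgroup.subset[OF lower_central_subgroup] by blast
  then show ?thesis
    using assms auto_rcos[OF assms(1) auto_lower_central[OF assms(1)] subgroup.subset[OF lower_central_subgroup]]
    by (force simp add: coset_act_def lower_central_quotient_def FactGroup_def RCOSETS_def)
qed

lemma andreadakis_iff:
  "\<alpha> \<in> andreadakis G k \<longleftrightarrow>
    \<alpha> \<in> auto G \<and> (\<forall>u\<in>carrier G. \<alpha> u \<otimes> inv u \<in> lower_central G (k - 1))"
proof (cases "\<alpha> \<in> auto G")
  case True
  interpret N: normal "lower_central G (k - 1)" G by (rule lower_central_normal)
  interpret h: group_hom G G \<alpha> using True by (rule auto_group_hom)
  have "coset_act (nilpotent_quotient G k) \<alpha> = \<one>\<^bsub>AutoGroup (nilpotent_quotient G k)\<^esub> \<longleftrightarrow>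
     (\<forall>X\<in>carrier (nilpotent_quotient G k). \<alpha> ` X = X)"
    by (auto simp: coset_act_def AutoGroup_def BijGroup_def restrict_def fun_eq_iff)
  also have "\<dots> \<longleftrightarrow> (\<forall>u\<in>carrier G. lower_central G (k - 1) #> \<alpha> u = lower_central G (k - 1) #> u)"
    using auto_rcos[OF True auto_lower_central[OF True] N.subset]
    by (simp add: nilpotent_quotient_def FactGroup_def RCOSETS_def)
  also have "\<dots> \<longleftrightarrow> (\<forall>u\<in>carrier G. \<alpha> u \<otimes> inv u \<in> lower_central G (k - 1))"
    using N.rcos_module[OF is_group] repr_independence rcos_self N.subgroup_axioms h.hom_closed by (metis repr_independenceD)
  finally show ?thesis using True by (simp add: andreadakis_def kernel_def) (simp add: AutoGroup_def)
qed (simp add: andreadakis_def kernel_def AutoGroup_def)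

lemma lower_central_quotient_comm: "comm_group (lower_central_quotient G (k + 2))"
proof -
  let ?A = "lower_central G k" and ?B = "lower_central G (Suc k)"
  interpret A: normal ?A G by (rule lower_central_normal)
  interpret B: normal ?B G by (rule lower_central_normal)
  interpret BA: normal ?B "G\<lparr>carrier := ?A\<rparr>"
    using normal_restrict_supergroup[OF A.subgroup_axioms lower_central_normal lower_central_Suc_subset] .
  have eq: "lower_central_quotient G (k + 2) = G\<lparr>carrier := ?A\<rparr> Mod ?B"
    by (simp add: lower_central_quotient_def)
  have "?B #> (x \<otimes> y) = ?B #> (y \<otimes> x)" if "x \<in> ?A" "y \<in> ?A" for x y
  proof -
    have c: "x \<in> carrier G" "y \<in> carrier G" using that A.subset by auto
    have "(x \<otimes> y) \<otimes> inv (y \<otimes> x) = x \<otimes> y \<otimes> inv x \<otimes> inv y"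
      using c by (simp add: inv_mult_group m_assoc)
    then have "(x \<otimes> y) \<otimes> inv (y \<otimes> x) \<in> ?B" 
      using commutator_in_lower_central[of x y k] that c by (simp only:)
    then have "x \<otimes> y \<in> ?B #> (y \<otimes> x)" using c by (simp only: B.rcos_module[OF is_group] m_closed)
    then show ?thesis using repr_independence B.subgroup_axioms c by (metis m_closed)
  qed
  then have "(?B #> x) <#> (?B #> y) = (?B #> y) <#> (?B #> x)" if "x \<in> ?A" "y \<in> ?A" for x y
    using that A.subset by (simp add: B.rcos_sum subset_iff)
  then show ?thesis unfolding eq
    by (intro group.group_comm_groupI BA.factorgroup_is_group) (auto simp: FactGroup_def RCOSETS_def)
qed

lemma johnson_map_hom:
  assumes \<alpha>: "\<alpha> \<in> andreadakis G k" and k: "k \<ge> 1"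
  shows "(\<lambda>u. lower_central G k #> (\<alpha> u \<otimes> inv u)) \<in> hom G (lower_central_quotient G (k + 1))"
proof -
  obtain j where j: "k = Suc j" using k by (cases k) auto
  let ?A = "lower_central G j" and ?B = "lower_central G (Suc j)"
  interpret A: normal ?A G by (rule lower_central_normal)
  interpret B: normal ?B G by (rule lower_central_normal)
  have eq: "lower_central_quotient G (k + 1) = G\<lparr>carrier := ?A\<rparr> Mod ?B"
    by (simp add: lower_central_quotient_def j)
  have aut: "\<alpha> \<in> auto G" and d: "\<And>u. u \<in> carrier G \<Longrightarrow> \<alpha> u \<otimes> inv u \<in> ?A"
    using \<alpha> by (auto simp: andreadakis_iff j)
  interpret h: group_hom G G \<alpha> using aut by (rule auto_group_hom)
  have "?B #> (\<alpha> (u \<otimes> v) \<otimes> inv (u \<otimes> v)) = (?B #> (\<alpha> u \<otimes> inv u)) <#> (?B #> (\<alpha> v \<otimes> inv v))"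
    if uv: "u \<in> carrier G" "v \<in> carrier G" for u v
  proof -
    have "(\<alpha> (u \<otimes> v) \<otimes> inv (u \<otimes> v)) \<otimes> inv ((\<alpha> u \<otimes> inv u) \<otimes> (\<alpha> v \<otimes> inv v))
      = \<alpha> u \<otimes> inv u \<otimes> (u \<otimes> (\<alpha> v \<otimes> inv v) \<otimes> inv u \<otimes> inv (\<alpha> v \<otimes> inv v)) \<otimes> inv (\<alpha> u \<otimes> inv u)"
    proof -
      have *: "inv x \<otimes> (x \<otimes> y) = y" if "x \<in> carrier G" "y \<in> carrier G" for x y
        using that by (simp flip: m_assoc)
      show ?thesis using uv by (simp add: m_assoc inv_mult_group * del: h.hom_inv)
    qed
    also have "\<dots> \<in> ?B"
      using commutator_in_lower_central[OF uv(1) d[OF uv(2)]] uv by (intro B.inv_op_closed2) auto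
    finally have "\<alpha> (u \<otimes> v) \<otimes> inv (u \<otimes> v) \<in> ?B #> ((\<alpha> u \<otimes> inv u) \<otimes> (\<alpha> v \<otimes> inv v))"
      using uv by (subst B.rcos_module[OF is_group]) auto
    then have "?B #> (\<alpha> (u \<otimes> v) \<otimes> inv (u \<otimes> v)) = ?B #> ((\<alpha> u \<otimes> inv u) \<otimes> (\<alpha> v \<otimes> inv v))"
      using repr_independence B.subgroup_axioms uv by (metis h.hom_closed inv_closed m_closed)
    then show ?thesis using uv by (simp add: B.rcos_sum)
  qed
  then show ?thesis unfolding eq using d
    by (intro homI, simp_all add: FactGroup_def RCOSETS_def j) blast
qed

lemma johnson_coset:
  assumes \<alpha>: "\<alpha> \<in> andreadakis G k" and k: "k \<ge> 1" and u: "u \<in> carrier G"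
  shows "johnson G k \<alpha> (derived G (carrier G) #> u) = lower_central G k #> (\<alpha> u \<otimes> inv u)"
proof -
  let ?D = "derived G (carrier G)" and ?L = "lower_central_quotient G (k + 1)"
  define d where "d = (\<lambda>u. lower_central G k #> (\<alpha> u \<otimes> inv u))"
  interpret D: normal ?D G by (rule derived_self_is_normal)
  interpret L: comm_group ?L
    using lower_central_quotient_comm[of "k - 1"] k by simp
  interpret h: group_hom G ?L d
    using johnson_map_hom[OF \<alpha> k] by unfold_locales (simp add: d_def)
  have "x \<otimes>\<^bsub>?L\<^esub> y \<otimes>\<^bsub>?L\<^esub> inv\<^bsub>?L\<^esub> x \<otimes>\<^bsub>?L\<^esub> inv\<^bsub>?L\<^esub> y = \<one>\<^bsub>?L\<^esub>"
    if "x \<in> carrier ?L" "y \<in> carrier ?L" for x y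
    using that by (metis L.inv_closed L.m_assoc L.m_comm L.r_inv L.r_one)
  then have comm: "d a \<otimes>\<^bsub>?L\<^esub> d b \<otimes>\<^bsub>?L\<^esub> inv\<^bsub>?L\<^esub> d a \<otimes>\<^bsub>?L\<^esub> inv\<^bsub>?L\<^esub> d b = \<one>\<^bsub>?L\<^esub>"
    if "a \<in> carrier G" "b \<in> carrier G" for a b
    using that h.hom_closed by blast
  have "?D \<subseteq> kernel G ?L d"
    unfolding derived_def
    by (rule generate_subgroup_incl[OF _ h.subgroup_kernel]) 
       (use comm in \<open>auto simp: kernel_def\<close>)
  then have "d (x \<otimes> u) = d u" if "x \<in> ?D" for x
  proof -
    have "x \<in> carrier G" "d x = \<one>\<^bsub>?L\<^esub>"
      using that D.subset \<open>?D \<subseteq> kernel G ?L d\<close> by (auto simp: kernel_def)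
    then show ?thesis using u h.hom_mult[of x u] L.l_one[OF h.hom_closed[OF u]] by simp
  qed
  then have "d ` (?D #> u) = {d u}"
    using rcos_self[OF u D.subgroup_axioms] by (auto simp: r_coset_def)
  then show ?thesis
    using rcosetsI[OF D.subset u]
    by (simp add: johnson_def abelianization_def FactGroup_def d_def)
qed

lemma johnson_in_target:
  assumes \<alpha>: "\<alpha> \<in> andreadakis G k" and k: "k \<ge> 1"
  shows "johnson G k \<alpha> \<in> carrier (johnson_target G k)"
proof -
  let ?D = "derived G (carrier G)"
  interpret D: normal ?D G by (rule derived_self_is_normal)
  note h = johnson_map_hom[OF \<alpha> k]
  have "johnson G k \<alpha> \<in> hom (abelianization G) (lower_central_quotient G (k + 1))"
    using hom_in_carrier[OF h] hom_mult[OF h]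
    by (intro homI)
       (auto simp: abelianization_def FactGroup_def RCOSETS_def johnson_coset[OF \<alpha> k] D.rcos_sum)
  then show ?thesis
    by (simp add: johnson_target_def hom_group_def johnson_def)
qed

end

end

theory Submission
  imports Defs Complex_Main "HOL-Algebra.Zassenhaus"
begin

text \<open>
  Let \<open>S\<close> be a free basis of the group. The Magnus expansion sends \<open>s \<in> S\<close> to \<open>1 + X\<^sub>s\<close> in the ring of
  noncommutative power series over \<open>\<int>\<close>. Write \<open>E\<close> for the series in the \<open>X\<^sub>s\<close>
  cut off after degree \<open>k\<close>; it is \<open>\<int>[\<pi>]\<close> modulo the power number \<open>k + 1\<close> of the augmentation
  ideal, so that an automorphism \<open>\<alpha>\<close> acts on it, by
  substituting \<open>magnus (\<alpha> s) - 1\<close> for \<open>X\<^sub>s\<close>. The lattice \<open>A\<close> is the group of all homomorphisms from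
  \<open>\<pi>\<close> to \<open>E\<close>, on which \<open>\<alpha>\<close> acts by \<open>f \<mapsto> \<alpha> \<circ> f \<circ> \<alpha>\<^sup>-\<^sup>1\<close>; such a homomorphism is determined by
  its arbitrary values on \<open>S\<close>, so \<open>A\<close> is free abelian of finite rank.

  If \<open>w\<close> lies in the term of the lower central series of which \<open>\<L>\<^bsub>k+1\<^esub>\<close> is a quotient, then
  \<open>magnus w - 1\<close> starts in degree \<open>k\<close> or later, and its truncation depends only on the class of \<open>w\<close>
  in \<open>\<L>\<^bsub>k+1\<^esub>\<close>. Composing with this map turns a homomorphism \<open>H \<rightarrow> \<L>\<^bsub>k+1\<^esub>\<close> into an element of
  \<open>A\<close>; this is \<open>\<eta>\<close>. The crossed homomorphism is the coboundary \<open>\<gamma> \<alpha> = \<alpha> \<cdot> \<sigma> - \<sigma>\<close> of the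
  element \<open>\<sigma>\<close> of \<open>A\<close> that takes \<open>u\<close> to the degree one part of \<open>magnus u\<close>. If \<open>\<alpha>\<close> acts trivially
  on \<open>\<Gamma>\<^sub>k\<close> with \<open>k \<ge> 2\<close>, it acts trivially on \<open>H\<close>, so \<open>\<sigma> \<circ> \<alpha>\<^sup>-\<^sup>1 = \<sigma>\<close>, and the value of \<open>\<gamma> \<alpha>\<close>
  at \<open>s\<close> is \<open>magnus (\<alpha> s) - magnus s\<close> up to degree \<open>k\<close>, which is the leading part of
  \<open>\<alpha> s \<otimes> inv s\<close>, i.e. the value of \<open>\<eta> (\<delta>\<^sub>k \<alpha>)\<close> (lemma \<open>act_linear_section\<close>).

  The deep point is that \<open>\<eta>\<close> is injective. This is the theorem of Magnus and Witt
  (\<open>magnus_dimension_subgroup\<close>): an element of the term number \<open>k\<close> of the lower central series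
  whose expansion has no part of degree \<open>k + 1\<close> lies in the term number \<open>k + 1\<close>. The proof given here is
  Lazard elimination. Modulo the next term, each term of the lower central series is generated by
  iterated commutators in the basis. If \<open>X\<close> is a set of commutators such that the iterated
  commutators in \<open>X\<close> generate in this sense, one may pick \<open>z \<in> X\<close> and
  replace \<open>X\<close> by the commutators \<open>[z,[z,\<dots>[z,y]]]\<close> with \<open>y \<in> X - {z}\<close>; in the weight of interest this loses at
  most the powers of \<open>z\<close> itself. A suitable order on words attaches to every member
  of \<open>X\<close> a leading word of its Lie polynomial, and if \<open>z\<close> is the least member in this
  order, the leading word of \<open>z\<close> does not occur in any Lie polynomial in the new letters.
  Therefore an element without part of the given degree involves \<open>z\<close> with exponent \<open>0\<close>. After
  finitely many eliminations no letter of the given weight or less is left.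
\<close>

section \<open>Noncommutative power series with integer coefficients\<close>

typedef 'a series = "UNIV :: ('a list \<Rightarrow> int) set" morphisms coeff Series ..

lemma coeff_Series [simp]: "coeff (Series f) w = f w"
  by (simp add: Series_inverse)

lemma series_eqI: "(\<And>w. coeff f w = coeff g w) \<Longrightarrow> f = g"
  by (metis coeff_inverse ext)

instantiation series :: (type) ring_1
begin

definition "0 = Series (\<lambda>w. 0)"
definition "1 = Series (\<lambda>w. if w = [] then 1 else 0)"
definition "f + g = Series (\<lambda>w. coeff f w + coeff g w)"
definition "f - g = Series (\<lambda>w. coeff f w - coeff g w)"
definition "- f = Series (\<lambda>w. - coeff f w)"
definition "f * g = Series (\<lambda>w. \<Sum>i\<le>length w. coeff f (take i w) * coeff g (drop i w))"

instance
proof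
  fix f g h :: "'a series"
  show "f * g * h = f * (g * h)"
  proof (rule series_eqI)
    fix w :: "'a list"
    let ?N = "length w"
    have "coeff (f * g * h) w = (\<Sum>i\<le>?N. \<Sum>j\<le>i.
        coeff f (take j w) * (coeff g (take (i - j) (drop j w)) * coeff h (drop i w)))"
      by (auto simp: times_series_def sum_distrib_right min_def drop_take mult.assoc intro!: sum.cong)
    also have "\<dots> = (\<Sum>j\<le>?N. \<Sum>i\<in>{j..?N}.
        coeff f (take j w) * (coeff g (take (i - j) (drop j w)) * coeff h (drop i w)))"
      by (simp add: sum.Sigma, rule sum.reindex_bij_witness[of _ "\<lambda>(j,i). (i,j)" "\<lambda>(i,j). (j,i)"]) auto
    also have "\<dots> = (\<Sum>j\<le>?N. \<Sum>i\<le>?N - j.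
        coeff f (take j w) * (coeff g (take i (drop j w)) * coeff h (drop (i + j) w)))"
    proof (rule sum.cong[OF refl])
      fix j assume "j \<in> {..?N}"
      then show "(\<Sum>i\<in>{j..?N}. coeff f (take j w) * (coeff g (take (i - j) (drop j w)) * coeff h (drop i w)))
          = (\<Sum>i\<le>?N - j. coeff f (take j w) * (coeff g (take i (drop j w)) * coeff h (drop (i + j) w)))"
        by (intro sum.reindex_bij_witness[of _ "\<lambda>i. i + j" "\<lambda>i. i - j"]) auto
    qed
    also have "\<dots> = coeff (f * (g * h)) w"
      by (simp add: times_series_def sum_distrib_left)
    finally show "coeff (f * g * h) w = coeff (f * (g * h)) w" .
  qed
  show "1 * f = f"
  proof (rule series_eqI)
    fix w :: "'a list"
    have "coeff (1 * f) w = (\<Sum>i\<le>length w. if i = 0 then coeff f w else 0)"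
      unfolding times_series_def one_series_def coeff_Series by (rule sum.cong) auto
    then show "coeff (1 * f) w = coeff f w" by simp
  qed
  show "f * 1 = f"
  proof (rule series_eqI)
    fix w :: "'a list"
    have "coeff (f * 1) w = (\<Sum>i\<le>length w. if i = length w then coeff f w else 0)"
      unfolding times_series_def one_series_def coeff_Series by (rule sum.cong) auto
    then show "coeff (f * 1) w = coeff f w" by simp
  qed
  show "(f + g) * h = f * h + g * h" "f * (g + h) = f * g + f * h"
    by (simp_all only: times_series_def plus_series_def coeff_Series distrib_left distrib_right sum.distrib)
  show "(0 :: 'a series) \<noteq> 1"
  proof
    assume "(0 :: 'a series) = 1"
    then have "coeff (0 :: 'a series) [] = coeff (1 :: 'a series) []" by (rule arg_cong)
    then show False by (simp add: zero_series_def one_series_def)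
  qed
  show "f + g + h = f + (g + h)" "f + g = g + f" "0 + f = f" "- f + f = 0" "f - g = f + - g"
    by (simp_all add: plus_series_def zero_series_def uminus_series_def minus_series_def algebra_simps coeff_inverse)
qed

end

lemma coeff_simps [simp]:
  "coeff 0 w = 0"
  "coeff (f + g) w = coeff f w + coeff g w"
  "coeff (f - g) w = coeff f w - coeff g w"
  "coeff (- f) w = - coeff f w"
  by (simp_all add: zero_series_def plus_series_def minus_series_def uminus_series_def)

lemma coeff_one: "coeff 1 w = (if w = [] then 1 else 0)"
  by (simp add: one_series_def)

lemma coeff_mult: "coeff (f * g) w = (\<Sum>i\<le>length w. coeff f (take i w) * coeff g (drop i w))"
  by (simp add: times_series_def)

lemma coeff_sum [simp]: "coeff (sum f I) w = (\<Sum>i\<in>I. coeff (f i) w)"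
  by (induction I rule: infinite_finite_induct) auto

lemma coeff_of_int_mult [simp]: "coeff (of_int c * f) w = c * coeff f w"
proof -
  have nat: "coeff (of_nat n * f) w = int n * coeff f w" for n
    by (induction n) (auto simp: algebra_simps)
  show ?thesis
  proof (cases c)
    case (nonneg n) then show ?thesis by (simp add: nat)
  next
    case (neg n) then show ?thesis using nat[of "Suc n"] by (simp del: of_nat_Suc)
  qed
qed

text \<open>The support of a product consists of concatenations; most statements on supports below
  are proved with this rule.\<close>

lemma coeff_mult_nonzeroE:
  assumes "coeff (f * g) w \<noteq> 0"
  obtains u v where "w = u @ v" "coeff f u \<noteq> 0" "coeff g v \<noteq> 0"
proof -
  obtain i where "coeff f (take i w) * coeff g (drop i w) \<noteq> 0"
    using assms unfolding coeff_mult by (meson sum.not_neutral_contains_not_neutral)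
  then show ?thesis by (intro that[of "take i w" "drop i w"]) auto
qed

definition series_var :: "'a \<Rightarrow> 'a series" where
  "series_var s = Series (\<lambda>w. if w = [s] then 1 else 0)"

text \<open>The geometric series for the inverse of \<open>1 + series_var s\<close>.\<close>

definition series_var_inv :: "'a \<Rightarrow> 'a series" where
  "series_var_inv s = Series (\<lambda>w. if set w \<subseteq> {s} then (- 1) ^ length w else 0)"

lemma coeff_var: "coeff (series_var s) w = (if w = [s] then 1 else 0)"
  by (simp add: series_var_def)

lemma coeff_var_mult_Nil: "coeff (series_var s * f) [] = 0"
  by (simp add: coeff_mult coeff_var)

lemma coeff_var_mult_Cons: "coeff (series_var s * f) (t # w) = (if t = s then coeff f w else 0)"
proof -
  have "coeff (series_var s * f) (t # w) = (\<Sum>i\<le>Suc (length w). if i = 1 then (if t = s then coeff f w else 0) else 0)"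
    unfolding coeff_mult by (rule sum.cong) (auto simp: coeff_var take_Cons' split: if_splits)
  also have "\<dots> = (if t = s then coeff f w else 0)" by (subst sum.delta) auto
  finally show ?thesis .
qed

lemma coeff_mult_var_Nil: "coeff (f * series_var s) [] = 0"
  by (simp add: coeff_mult coeff_var)

lemma coeff_mult_var_snoc: "coeff (f * series_var s) (w @ [t]) = (if t = s then coeff f w else 0)"
proof -
  have 1: "drop i (w @ [t]) = [s] \<longleftrightarrow> i = length w \<and> t = s" if "i \<le> length (w @ [t])" for i
  proof
    assume *: "drop i (w @ [t]) = [s]"
    then have "length (w @ [t]) - i = 1" by (metis length_drop One_nat_def list.size(3,4) plus_1_eq_Suc add.commute)
    then have "i = length w" by simp
    then show "i = length w \<and> t = s" using * by simp
  qed auto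
  have "coeff (f * series_var s) (w @ [t]) = (\<Sum>i\<le>length (w @ [t]). if i = length w then (if t = s then coeff f w else 0) else 0)"
    unfolding coeff_mult by (rule sum.cong) (use 1 in \<open>auto simp: coeff_var\<close>)
  then show ?thesis by simp
qed

lemma var_inverse:
  "(1 + series_var s) * series_var_inv s = 1"
  "series_var_inv s * (1 + series_var s) = 1"
proof -
  show "(1 + series_var s) * series_var_inv s = 1"
  proof (rule series_eqI)
    fix w show "coeff ((1 + series_var s) * series_var_inv s) w = coeff 1 w"
      by (cases w) (auto simp: distrib_right coeff_var_mult_Nil coeff_var_mult_Cons series_var_inv_def coeff_one)
  qed
  show "series_var_inv s * (1 + series_var s) = 1"
  proof (rule series_eqI)
    fix w show "coeff (series_var_inv s * (1 + series_var s)) w = coeff 1 w"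
      by (cases w rule: rev_cases) (auto simp: distrib_left coeff_mult_var_Nil coeff_mult_var_snoc series_var_inv_def coeff_one)
  qed
qed

text \<open>This filtration corresponds to the one of the group ring by powers of the augmentation
  ideal.\<close>

definition order_ideal :: "nat \<Rightarrow> 'a series set" where
  "order_ideal n = {f. \<forall>w. length w < n \<longrightarrow> coeff f w = 0}"

lemma order_ideal_add: "f \<in> order_ideal n \<Longrightarrow> g \<in> order_ideal n \<Longrightarrow> f + g \<in> order_ideal n"
  and order_ideal_diff: "f \<in> order_ideal n \<Longrightarrow> g \<in> order_ideal n \<Longrightarrow> f - g \<in> order_ideal n"
  and order_ideal_zero: "0 \<in> order_ideal n"
  by (auto simp: order_ideal_def)

lemma order_ideal_mono: "f \<in> order_ideal n \<Longrightarrow> m \<le> n \<Longrightarrow> f \<in> order_ideal m"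
  by (auto simp: order_ideal_def)

lemma order_ideal_mult:
  assumes "f \<in> order_ideal m" "g \<in> order_ideal n"
  shows "f * g \<in> order_ideal (m + n)"
  unfolding order_ideal_def
proof (intro CollectI allI impI)
  fix w :: "'a list" assume w: "length w < m + n"
  have "\<not> (coeff (f * g) w \<noteq> 0)"
  proof
    assume "coeff (f * g) w \<noteq> 0"
    then obtain u v where uv: "w = u @ v" "coeff f u \<noteq> 0" "coeff g v \<noteq> 0" by (rule coeff_mult_nonzeroE)
    then have "m \<le> length u" "n \<le> length v" using assms by (auto simp: order_ideal_def not_less[symmetric])
    then show False using w uv by simp
  qed
  then show "coeff (f * g) w = 0" by simp
qed

lemma order_ideal_mult_right: "f \<in> order_ideal m \<Longrightarrow> f * g \<in> order_ideal m"
  using order_ideal_mult[of f m g 0] by (simp add: order_ideal_def)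

lemma order_ideal_mult_left: "g \<in> order_ideal m \<Longrightarrow> f * g \<in> order_ideal m"
  using order_ideal_mult[of f 0 g m] by (simp add: order_ideal_def)

definition trunc :: "nat \<Rightarrow> 'a series \<Rightarrow> 'a series" where
  "trunc k f = Series (\<lambda>w. if length w \<le> k then coeff f w else 0)"

lemma coeff_trunc: "coeff (trunc k f) w = (if length w \<le> k then coeff f w else 0)"
  by (simp add: trunc_def)

lemma trunc_add: "trunc k (f + g) = trunc k f + trunc k g"
  and trunc_diff: "trunc k (f - g) = trunc k f - trunc k g"
  and trunc_zero: "trunc k 0 = 0"
  by (auto intro!: series_eqI simp: coeff_trunc)

lemma trunc_eq_iff: "trunc k f = trunc k g \<longleftrightarrow> f - g \<in> order_ideal (Suc k)"
proof
  assume "trunc k f = trunc k g"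
  then have "coeff (trunc k f) w = coeff (trunc k g) w" for w by simp
  from this[unfolded coeff_trunc] show "f - g \<in> order_ideal (Suc k)"
    by (simp add: order_ideal_def less_Suc_eq_le) meson
qed (auto simp: order_ideal_def coeff_trunc less_Suc_eq_le intro!: series_eqI)

section \<open>Commutators and the lower central series\<close>

context group
begin

definition comm :: "'a \<Rightarrow> 'a \<Rightarrow> 'a" where
  "comm x y = x \<otimes> y \<otimes> inv x \<otimes> inv y"

lemma comm_closed [simp]: "x \<in> carrier G \<Longrightarrow> y \<in> carrier G \<Longrightarrow> comm x y \<in> carrier G"
  by (simp add: comm_def)

lemma inv_mult_cancel: 
  "x \<in> carrier G \<Longrightarrow> y \<in> carrier G \<Longrightarrow> inv x \<otimes> (x \<otimes> y) = y"
  "x \<in> carrier G \<Longrightarrow> y \<in> carrier G \<Longrightarrow> x \<otimes> (inv x \<otimes> y) = y"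
  by (simp_all flip: m_assoc)

lemmas group_normalize = comm_def m_assoc inv_mult_group inv_mult_cancel

lemma inv_comm: "x \<in> carrier G \<Longrightarrow> y \<in> carrier G \<Longrightarrow> inv (comm x y) = comm y x"
  by (simp add: group_normalize)

text \<open>The group-theoretic form of the Jacobi identity: free reduction of the left-hand side leaves the
  empty word.\<close>

lemma hall_witt:
  assumes "x \<in> carrier G" "y \<in> carrier G" "z \<in> carrier G"
  shows "(y \<otimes> comm x (comm (inv y) z) \<otimes> inv y) \<otimes> (z \<otimes> comm y (comm (inv z) x) \<otimes> inv z)
    \<otimes> (x \<otimes> comm z (comm (inv x) y) \<otimes> inv x) = \<one>"
  using assms by (simp add: group_normalize)

lemma conj_mem_normal_iff:
  assumes "N \<lhd> G" "g \<in> carrier G" "x \<in> carrier G"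
  shows "g \<otimes> x \<otimes> inv g \<in> N \<longleftrightarrow> x \<in> N"
proof
  interpret N: normal N G by fact
  assume "g \<otimes> x \<otimes> inv g \<in> N"
  then have "inv g \<otimes> (g \<otimes> x \<otimes> inv g) \<otimes> g \<in> N" using assms by (intro N.inv_op_closed1)
  then show "x \<in> N" using assms by (simp add: group_normalize)
next
  interpret N: normal N G by fact
  show "x \<in> N \<Longrightarrow> g \<otimes> x \<otimes> inv g \<in> N" using assms by (intro N.inv_op_closed2)
qed

lemma comm_swap_mem:
  assumes "subgroup N G" "x \<in> carrier G" "y \<in> carrier G" "comm x y \<in> N"
  shows "comm y x \<in> N"
  using subgroup.m_inv_closed[OF assms(1,4)] assms by (simp add: inv_comm)

text \<open>This is the preimage of the centralizer of \<open>y\<close> in the quotient by \<open>N\<close>. It replaces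
  computations with commutators modulo \<open>N\<close> by checks on generators.\<close>

lemma subgroup_commuting_mod:
  assumes "N \<lhd> G" "y \<in> carrier G"
  shows "subgroup {x \<in> carrier G. comm y x \<in> N} G"
proof -
  interpret N: normal N G by fact
  show ?thesis
  proof (rule subgroupI)
    show "{x \<in> carrier G. comm y x \<in> N} \<noteq> {}"
      using assms by (auto simp: group_normalize intro!: exI[of _ \<one>])
    fix a assume a: "a \<in> {x \<in> carrier G. comm y x \<in> N}"
    then have "inv a \<otimes> inv (comm y a) \<otimes> a \<in> N" using assms by (intro N.inv_op_closed1) auto
    moreover have "inv a \<otimes> inv (comm y a) \<otimes> a = comm y (inv a)"
      using a assms by (simp add: group_normalize)
    ultimately show "inv a \<in> {x \<in> carrier G. comm y x \<in> N}" using a by simp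
    fix b assume b: "b \<in> {x \<in> carrier G. comm y x \<in> N}"
    have "comm y a \<otimes> (a \<otimes> comm y b \<otimes> inv a) \<in> N"
      using a b assms by (intro N.m_closed N.inv_op_closed2) auto
    moreover have "comm y a \<otimes> (a \<otimes> comm y b \<otimes> inv a) = comm y (a \<otimes> b)"
      using a b assms by (simp add: group_normalize)
    ultimately show "a \<otimes> b \<in> {x \<in> carrier G. comm y x \<in> N}" using a b by simp
  qed auto
qed

lemma comm_generate_mem:
  assumes N: "N \<lhd> G" and A: "A \<subseteq> carrier G" and B: "B \<subseteq> carrier G"
    and AB: "\<And>a b. a \<in> A \<Longrightarrow> b \<in> B \<Longrightarrow> comm a b \<in> N"
    and a: "a \<in> generate G A" and b: "b \<in> generate G B"
  shows "comm a b \<in> N"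
proof -
  note sN = normal_imp_subgroup[OF N]
  have bc: "b \<in> carrier G" using b generate_in_carrier[OF B] by blast
  have 1: "comm a' b \<in> N" if "a' \<in> A" for a'
  proof -
    have "generate G B \<subseteq> {x \<in> carrier G. comm a' x \<in> N}"
      using that AB A B by (intro generate_subgroup_incl subgroup_commuting_mod[OF N]) auto
    then show ?thesis using b by blast
  qed
  have "generate G A \<subseteq> {x \<in> carrier G. comm b x \<in> N}"
    using A bc by (intro generate_subgroup_incl subgroup_commuting_mod[OF N]) (auto intro!: comm_swap_mem[OF sN] 1)
  then show ?thesis using a bc comm_swap_mem[OF sN bc] by blast
qed

text \<open>The three subgroups argument: modulo \<open>N\<close>, two of the factors in the Hall-Witt identity
  are trivial, hence so is the third.\<close>

lemma hall_witt_mem: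
  assumes N: "N \<lhd> G" and xyz: "x \<in> carrier G" "y \<in> carrier G" "z \<in> carrier G"
    and 1: "comm (inv y) (comm (inv z) x) \<in> N" and 2: "comm z (comm (inv x) (inv y)) \<in> N"
  shows "comm x (comm y z) \<in> N"
proof -
  interpret N: normal N G by fact
  let ?p = "inv y \<otimes> comm x (comm y z) \<otimes> y"
  let ?q = "z \<otimes> comm (inv y) (comm (inv z) x) \<otimes> inv z"
  let ?r = "x \<otimes> comm z (comm (inv x) (inv y)) \<otimes> inv x"
  have q: "?q \<in> N" "?r \<in> N" using 1 2 xyz by (auto intro: N.inv_op_closed2)
  have "?p \<otimes> ?q \<otimes> ?r = \<one>" using hall_witt[of x "inv y" z] xyz by simp
  then have "?p \<otimes> (?q \<otimes> ?r) = \<one>" using xyz by (subst m_assoc[symmetric]) auto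
  then have "inv (?q \<otimes> ?r) = ?p" using xyz by (intro inv_equality) auto
  moreover have "inv (?q \<otimes> ?r) \<in> N" by (intro N.m_inv_closed N.m_closed q)
  ultimately have "?p \<in> N" by simp
  then show ?thesis using conj_mem_normal_iff[OF N, of "inv y" "comm x (comm y z)"] xyz by simp
qed

lemma lower_central_carrier: "x \<in> lower_central G k \<Longrightarrow> x \<in> carrier G"
  using subgroup.subset[OF lower_central_subgroup] by blast

lemma lower_central_antimono: "i \<le> j \<Longrightarrow> lower_central G j \<subseteq> lower_central G i"
  by (rule lift_Suc_antimono_le[of "lower_central G"]) (rule lower_central_Suc_subset)

text \<open>By induction on \<open>i\<close>: for a generator \<open>[a, b]\<close> of the term number \<open>Suc i\<close>, the
  Hall-Witt identity trades \<open>[y, [a, b]]\<close> for commutators that involve the term number \<open>i\<close> only.\<close>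

lemma comm_lower_central:
  "x \<in> lower_central G i \<Longrightarrow> y \<in> lower_central G j \<Longrightarrow> comm x y \<in> lower_central G (Suc (i + j))"
proof (induction i arbitrary: x y j)
  case 0
  then show ?case using commutator_in_lower_central[of x y j] by (simp add: comm_def)
next
  case (Suc i)
  let ?N = "lower_central G (Suc (Suc i + j))"
  note N = lower_central_normal[of "Suc (Suc i + j)"]
  have y: "y \<in> carrier G" using Suc.prems lower_central_carrier by blast
  have step: "comm y (comm a b) \<in> ?N" if ab: "a \<in> carrier G" "b \<in> lower_central G i" for a b
  proof (rule hall_witt_mem[OF N y])
    show b: "a \<in> carrier G" "b \<in> carrier G" using ab lower_central_carrier by auto
    have "comm (inv b) y \<in> lower_central G (Suc (i + j))"
      using Suc ab by (auto intro: subgroup.m_inv_closed[OF lower_central_subgroup])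
    then show "comm (inv a) (comm (inv b) y) \<in> ?N"
      using commutator_in_lower_central[of "inv a"] b by (simp add: comm_def)
    have "comm (inv a) (inv y) \<in> lower_central G (Suc j)"
      using commutator_in_lower_central[of "inv a" "inv y" j] b Suc.prems
        subgroup.m_inv_closed[OF lower_central_subgroup] by (simp add: comm_def)
    then have "comm (inv y) (inv a) \<in> lower_central G (Suc j)"
      using b y by (intro comm_swap_mem[OF lower_central_subgroup _ _ \<open>comm (inv a) (inv y) \<in> _\<close>]) auto
    then show "comm b (comm (inv y) (inv a)) \<in> ?N"
      using Suc.IH[OF ab(2)] by fastforce
  qed
  have "lower_central G (Suc i) \<subseteq> {x \<in> carrier G. comm y x \<in> ?N}"
    unfolding lower_central.simps(2)[of G i] commutator_subgroup_def
    by (intro generate_subgroup_incl subgroup_commuting_mod[OF N] y)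
       (use step lower_central_carrier in \<open>auto simp flip: comm_def\<close>)
  then show ?case
    using Suc.prems lower_central_carrier by (intro comm_swap_mem[OF lower_central_subgroup y]) auto
qed

end

section \<open>The Magnus expansion of a free group\<close>

locale free_group_on_basis = group G for G (structure) +
  fixes S :: "'a set"
  assumes free_basis: "free_basis G S" and finite_basis: "finite S"
begin

lemma basis_closed: "s \<in> S \<Longrightarrow> s \<in> carrier G"
  using free_basis by (auto simp: free_basis_def)

lemma word_val_Nil: "word_val G [] = \<one>"
  and word_val_Cons: "word_val G ((s, b) # w) = (if b then s else inv s) \<otimes> word_val G w"
  by (simp_all add: word_val_def)

lemma word_val_closed: "fst ` set w \<subseteq> S \<Longrightarrow> word_val G w \<in> carrier G"
  by (induction w) (auto simp: word_val_Nil word_val_Cons basis_closed)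

definition reduced_form :: "'a \<Rightarrow> ('a \<times> bool) list" where
  "reduced_form g = the_inv_into (reduced_words S) (word_val G) g"

lemma reduced_form:
  assumes "g \<in> carrier G"
  shows "reduced_form g \<in> reduced_words S" "word_val G (reduced_form g) = g"
  using free_basis assms the_inv_into_into[of "word_val G" "reduced_words S" g]
  by (auto simp: reduced_form_def free_basis_def bij_betw_def f_the_inv_into_f)

lemma reduced_form_word_val: "w \<in> reduced_words S \<Longrightarrow> reduced_form (word_val G w) = w"
  using free_basis by (auto simp: reduced_form_def free_basis_def bij_betw_def the_inv_into_f_f)

text \<open>Induction on a word that represents the element.\<close>

lemma free_induct [consumes 1, case_names one letter inv_letter]:
  assumes g: "g \<in> carrier G" and one: "P \<one>"
    and "\<And>s g. s \<in> S \<Longrightarrow> g \<in> carrier G \<Longrightarrow> P g \<Longrightarrow> P (s \<otimes> g)"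
    and "\<And>s g. s \<in> S \<Longrightarrow> g \<in> carrier G \<Longrightarrow> P g \<Longrightarrow> P (inv s \<otimes> g)"
  shows "P g"
proof -
  have "fst ` set w \<subseteq> S \<Longrightarrow> P (word_val G w)" for w
    by (induction w) (auto simp: word_val_Nil word_val_Cons word_val_closed assms(2-4) )
  from this[of "reduced_form g"] show ?thesis
    using reduced_form[OF g] by (simp add: reduced_words_def)
qed

definition magnus_letter :: "'a \<times> bool \<Rightarrow> 'a series" where
  "magnus_letter = (\<lambda>(s, b). if b then 1 + series_var s else series_var_inv s)"

definition magnus :: "'a \<Rightarrow> 'a series" where
  "magnus g = prod_list (map magnus_letter (reduced_form g))"

lemma magnus_letter_cancel: "magnus_letter (s, b) * (magnus_letter (s, \<not> b) * f) = f"
  by (cases b) (simp_all add: magnus_letter_def var_inverse flip: mult.assoc)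

text \<open>Multiplication by a letter either prolongs the reduced word or cancels its first letter,
  and the letter and its inverse have inverse expansions.\<close>

lemma magnus_letter_mult:
  assumes s: "s \<in> S" and g: "g \<in> carrier G"
  shows "magnus ((if b then s else inv s) \<otimes> g) = magnus_letter (s, b) * magnus g"
proof -
  let ?w = "reduced_form g"
  note w = reduced_form[OF g]
  show ?thesis
  proof (cases "(s, b) # ?w \<in> reduced_words S")
    case True
    from reduced_form_word_val[OF this] show ?thesis
      by (simp add: word_val_Cons w magnus_def)
  next
    case False
    then obtain w' where w': "?w = (s, \<not> b) # w'"
      using s w by (cases ?w) (auto simp: reduced_words_def successively_Cons)
    have red: "w' \<in> reduced_words S"
      using w(1) by (auto simp: w' reduced_words_def successively_Cons)
    then have "(if b then s else inv s) \<otimes> g = word_val G w'"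
      using w(2) s by (auto simp: w' word_val_Cons inv_mult_cancel basis_closed word_val_closed reduced_words_def)
    then show ?thesis
      by (simp add: magnus_def reduced_form_word_val[OF red] w' magnus_letter_cancel)
  qed
qed

lemma magnus_one: "magnus \<one> = 1"
proof -
  have "[] \<in> reduced_words S" by (simp add: reduced_words_def)
  then show ?thesis using reduced_form_word_val[of "[]"] by (simp add: magnus_def word_val_Nil)
qed

lemma magnus_mult:
  assumes "g \<in> carrier G" "h \<in> carrier G"
  shows "magnus (g \<otimes> h) = magnus g * magnus h"
  using assms(1)
proof (induction rule: free_induct)
  case one
  then show ?case using assms(2) by (simp add: magnus_one)
next
  case (letter s g)
  then show ?case using assms(2) magnus_letter_mult[of s _ True]
    by (simp add: m_assoc basis_closed mult.assoc)
next
  case (inv_letter s g)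
  then show ?case using assms(2) magnus_letter_mult[of s _ False]
    by (simp add: m_assoc basis_closed mult.assoc)
qed

lemma magnus_basis: "s \<in> S \<Longrightarrow> magnus s = 1 + series_var s"
  using magnus_letter_mult[of s "\<one>" True] by (simp add: magnus_one basis_closed magnus_letter_def)

lemma magnus_inv:
  assumes "g \<in> carrier G"
  shows "magnus g * magnus (inv g) = 1" "magnus (inv g) * magnus g = 1"
  using assms by (simp_all add: magnus_one flip: magnus_mult)

lemma coeff_magnus_Nil: "g \<in> carrier G \<Longrightarrow> coeff (magnus g) [] = 1"
proof (induction rule: free_induct)
  case one then show ?case by (simp add: magnus_one coeff_one)
next
  case (letter s g)
  then show ?case by (simp add: magnus_mult basis_closed coeff_mult magnus_basis coeff_one coeff_var)
next
  case (inv_letter s g)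
  have "coeff (magnus s * magnus (inv s)) [] = 1"
    using inv_letter by (simp add: magnus_inv basis_closed coeff_one)
  then have "coeff (magnus (inv s)) [] = 1"
    using inv_letter by (simp add: coeff_mult magnus_basis coeff_one coeff_var)
  then show ?case using inv_letter by (simp add: magnus_mult basis_closed coeff_mult)
qed

lemma magnus_minus_one: "g \<in> carrier G \<Longrightarrow> magnus g - 1 \<in> order_ideal (Suc 0)"
  by (simp add: order_ideal_def coeff_magnus_Nil coeff_one)

lemma coeff_magnus_support:
  assumes "g \<in> carrier G" "coeff (magnus g) w \<noteq> 0"
  shows "set w \<subseteq> S"
  using assms
proof (induction arbitrary: w rule: free_induct)
  case one then show ?case by (auto simp: magnus_one coeff_one split: if_splits)
next
  case (letter s g)
  then have "coeff (magnus_letter (s, True) * magnus g) w \<noteq> 0"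
    using magnus_letter_mult[of s g True] by simp
  then obtain u v where "w = u @ v" "coeff (magnus_letter (s, True)) u \<noteq> 0" "coeff (magnus g) v \<noteq> 0"
    by (rule coeff_mult_nonzeroE)
  then show ?case using letter by (force simp: magnus_letter_def coeff_one coeff_var split: if_splits)
next
  case (inv_letter s g)
  then have "coeff (magnus_letter (s, False) * magnus g) w \<noteq> 0"
    using magnus_letter_mult[of s g False] by simp
  then obtain u v where "w = u @ v" "coeff (magnus_letter (s, False)) u \<noteq> 0" "coeff (magnus g) v \<noteq> 0"
    by (rule coeff_mult_nonzeroE)
  then show ?case using inv_letter by (force simp: magnus_letter_def series_var_inv_def split: if_splits)
qed

text \<open>The elements congruent to \<open>1\<close> modulo the power number \<open>d\<close> of the augmentation ideal of
  the group ring.\<close>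

definition dimension_subgroup :: "nat \<Rightarrow> 'a set" where
  "dimension_subgroup d = {g \<in> carrier G. magnus g - 1 \<in> order_ideal d}"

text \<open>In the lowest degree where the expansions differ from \<open>1\<close>, multiplication becomes
  addition.\<close>

lemma magnus_mult_mod:
  assumes "g \<in> dimension_subgroup d" "h \<in> dimension_subgroup e"
  shows "(magnus (g \<otimes> h) - 1) - ((magnus g - 1) + (magnus h - 1)) \<in> order_ideal (d + e)"
proof -
  have "(magnus (g \<otimes> h) - 1) - ((magnus g - 1) + (magnus h - 1)) = (magnus g - 1) * (magnus h - 1)"
    using assms by (simp add: dimension_subgroup_def magnus_mult algebra_simps)
  then show ?thesis using assms order_ideal_mult by (auto simp: dimension_subgroup_def)
qed

lemma dimension_subgroup_antimono: "i \<le> j \<Longrightarrow> dimension_subgroup j \<subseteq> dimension_subgroup i"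
  by (auto simp: dimension_subgroup_def intro: order_ideal_mono)

lemma subgroup_dimension_subgroup: "subgroup (dimension_subgroup d) G"
proof (rule subgroupI)
  show "dimension_subgroup d \<subseteq> carrier G" by (auto simp: dimension_subgroup_def)
  show "dimension_subgroup d \<noteq> {}" 
    by (auto simp: dimension_subgroup_def magnus_one order_ideal_zero intro!: exI[of _ \<one>])
  fix g assume g: "g \<in> dimension_subgroup d"
  then have gc: "g \<in> carrier G" by (simp add: dimension_subgroup_def)
  have "magnus (inv g) - 1 = 0 - magnus (inv g) * (magnus g - 1)"
    using magnus_inv[OF gc] by (simp add: algebra_simps)
  also have "\<dots> \<in> order_ideal d"
    by (rule order_ideal_diff[OF order_ideal_zero], rule order_ideal_mult_left)
       (use g in \<open>simp add: dimension_subgroup_def\<close>)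
  finally show "inv g \<in> dimension_subgroup d"
    using gc by (simp add: dimension_subgroup_def)
  fix h assume h: "h \<in> dimension_subgroup d"
  have "magnus (g \<otimes> h) - 1 = (magnus g - 1) * magnus h + (magnus h - 1)"
    using g h by (simp add: dimension_subgroup_def magnus_mult algebra_simps)
  also have "\<dots> \<in> order_ideal d"
    by (rule order_ideal_add[OF order_ideal_mult_right]) (use g h in \<open>simp_all add: dimension_subgroup_def\<close>)
  finally show "g \<otimes> h \<in> dimension_subgroup d"
    using g h by (simp add: dimension_subgroup_def)
qed

text \<open>With \<open>A = magnus a - 1\<close> and \<open>B = magnus b - 1\<close>, the series \<open>magnus (comm a b) - 1\<close> is
  \<open>(A * B - B * A) * R\<close> for a series \<open>R\<close> with constant term \<open>1\<close>. Hence the leading part of a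
  commutator is the Lie bracket of the leading parts.\<close>

lemma magnus_comm_mod:
  assumes a: "a \<in> dimension_subgroup d" "magnus a - 1 - f \<in> order_ideal (Suc d)" "f \<in> order_ideal d"
    and b: "b \<in> dimension_subgroup e" "magnus b - 1 - g \<in> order_ideal (Suc e)" "g \<in> order_ideal e"
  shows "magnus (comm a b) - 1 - (f * g - g * f) \<in> order_ideal (Suc (d + e))"
proof -
  have c: "a \<in> carrier G" "b \<in> carrier G" using a b by (auto simp: dimension_subgroup_def)
  define A where "A = magnus a - 1"
  define B where "B = magnus b - 1"
  define R where "R = magnus (inv (b \<otimes> a))"
  have AB: "A \<in> order_ideal d" "B \<in> order_ideal e" using a b by (auto simp: A_def B_def dimension_subgroup_def)
  have R: "R - 1 \<in> order_ideal (Suc 0)" using c by (auto simp: R_def intro: magnus_minus_one)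
  have "comm a b = (a \<otimes> b) \<otimes> inv (b \<otimes> a)" using c by (simp add: group_normalize)
  then have "magnus (comm a b) = magnus (a \<otimes> b) * R" using c by (simp add: magnus_mult R_def)
  moreover have "magnus (b \<otimes> a) * R = 1" using c by (simp add: R_def magnus_inv)
  ultimately have "magnus (comm a b) - 1 = (magnus (a \<otimes> b) - magnus (b \<otimes> a)) * R"
    by (simp add: algebra_simps)
  also have "magnus (a \<otimes> b) - magnus (b \<otimes> a) = A * B - B * A"
    using c by (simp add: magnus_mult A_def B_def algebra_simps)
  finally have *: "magnus (comm a b) - 1 - (f * g - g * f)
    = (A * B - B * A) * (R - 1) + ((A - f) * B + f * (B - g)) - ((B - g) * A + g * (A - f))"
    by (simp add: algebra_simps)
  have 1: "(A * B - B * A) * (R - 1) \<in> order_ideal (Suc (d + e))"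
    using order_ideal_mult[OF order_ideal_diff[OF order_ideal_mult[OF AB]] R] order_ideal_mult[OF AB(2,1)]
    by (simp add: add.commute)
  have 2: "(A - f) * B \<in> order_ideal (Suc (d + e))" "f * (B - g) \<in> order_ideal (Suc (d + e))"
    "(B - g) * A \<in> order_ideal (Suc (d + e))" "g * (A - f) \<in> order_ideal (Suc (d + e))"
    using order_ideal_mult[of "A - f" "Suc d" B e] order_ideal_mult[of f d "B - g" "Suc e"]
      order_ideal_mult[of "B - g" "Suc e" A d] order_ideal_mult[of g e "A - f" "Suc d"] AB a b
    by (simp_all add: A_def B_def add.commute)
  show ?thesis unfolding * by (intro order_ideal_diff order_ideal_add 1 2)
qed

lemma comm_dimension_subgroup:
  assumes "a \<in> dimension_subgroup d" "b \<in> dimension_subgroup e"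
  shows "comm a b \<in> dimension_subgroup (d + e)"
proof -
  have c: "a \<in> carrier G" "b \<in> carrier G" "magnus a - 1 \<in> order_ideal d" "magnus b - 1 \<in> order_ideal e"
    using assms by (auto simp: dimension_subgroup_def)
  let ?f = "magnus a - 1" and ?g = "magnus b - 1"
  have "magnus (comm a b) - 1 - (?f * ?g - ?g * ?f) \<in> order_ideal (Suc (d + e))"
    by (rule magnus_comm_mod[OF assms(1) _ c(3) assms(2) _ c(4)]) (simp_all add: order_ideal_zero)
  then have "magnus (comm a b) - 1 - (?f * ?g - ?g * ?f) \<in> order_ideal (d + e)"
    by (rule order_ideal_mono) simp
  moreover have "?f * ?g - ?g * ?f \<in> order_ideal (d + e)"
    using order_ideal_mult[OF c(3,4)] order_ideal_mult[OF c(4,3)] by (auto simp: add.commute intro: order_ideal_diff)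
  ultimately have "magnus (comm a b) - 1 \<in> order_ideal (d + e)"
    using order_ideal_add by fastforce
  then show ?thesis using c by (simp add: dimension_subgroup_def)
qed

lemma lower_central_subset_dimension_subgroup: "lower_central G k \<subseteq> dimension_subgroup (Suc k)"
proof (induction k)
  case 0
  then show ?case using magnus_minus_one by (auto simp: dimension_subgroup_def)
next
  case (Suc k)
  have "comm a b \<in> dimension_subgroup (Suc (Suc k))" if "a \<in> carrier G" "b \<in> lower_central G k" for a b
    using comm_dimension_subgroup[of a "Suc 0" b "Suc k"] that Suc magnus_minus_one 
    by (auto simp: dimension_subgroup_def)
  then show ?case
    unfolding lower_central.simps commutator_subgroup_def
    by (intro generate_subgroup_incl[OF _ subgroup_dimension_subgroup]) (auto simp flip: comm_def)
qed

end

section \<open>Bracket expressions and elimination of a letter\<close>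

text \<open>An iterated commutator is kept as a tree, because it is evaluated both in the group and,
  as a Lie polynomial, in the ring of series, and because trees over trees are again trees: after an
  elimination the new letters have the same type as the old ones.\<close>

datatype 'a bracket = Leaf 'a | Br "'a bracket" "'a bracket"

primrec leaves :: "'a bracket \<Rightarrow> 'a list" where
  "leaves (Leaf s) = [s]"
| "leaves (Br a b) = leaves a @ leaves b"

abbreviation weight :: "'a bracket \<Rightarrow> nat" where
  "weight c \<equiv> length (leaves c)"

lemma leaves_nonempty [simp]: "leaves c \<noteq> []"
  by (induction c) auto

lemma weight_pos: "0 < weight c"
  by simp

primrec lie_series :: "'a bracket \<Rightarrow> 'a series" where
  "lie_series (Leaf s) = series_var s"
| "lie_series (Br a b) = lie_series a * lie_series b - lie_series b * lie_series a"

inductive_set brackets_over :: "'a bracket set \<Rightarrow> 'a bracket set" for X where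
  base: "x \<in> X \<Longrightarrow> x \<in> brackets_over X"
| bracket: "a \<in> brackets_over X \<Longrightarrow> b \<in> brackets_over X \<Longrightarrow> Br a b \<in> brackets_over X"

lemma leaves_brackets_over:
  "c \<in> brackets_over X \<Longrightarrow> (\<And>x. x \<in> X \<Longrightarrow> set (leaves x) \<subseteq> S) \<Longrightarrow> set (leaves c) \<subseteq> S"
  by (induction rule: brackets_over.induct) auto

lemma brackets_over_empty: "brackets_over {} = {}"
proof -
  have "c \<in> brackets_over {} \<Longrightarrow> False" for c :: "'a bracket"
    by (induction rule: brackets_over.induct) auto
  then show ?thesis by blast
qed

text \<open>The letters after elimination of \<open>z\<close>: the iterated brackets \<open>[z,[z,\<dots>[z,y]]]\<close> with
  \<open>y \<noteq> z\<close>. The bound on the weight keeps the alphabet finite; heavier brackets do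
  not influence what happens in weight at most \<open>m\<close>.\<close>

definition eliminate :: "nat \<Rightarrow> 'a bracket \<Rightarrow> 'a bracket set \<Rightarrow> 'a bracket set" where
  "eliminate m z X = {c. weight c \<le> m \<and> (\<exists>j. \<exists>y\<in>X - {z}. c = (Br z ^^ j) y)}"

lemma leaves_Br_power: "leaves ((Br z ^^ j) y) = concat (replicate j (leaves z)) @ leaves y"
  by (induction j) auto

lemma eliminate_leaves:
  assumes "\<And>x. x \<in> X \<Longrightarrow> set (leaves x) \<subseteq> S" "z \<in> X" "c \<in> eliminate m z X"
  shows "set (leaves c) \<subseteq> S"
  using assms by (fastforce simp: eliminate_def leaves_Br_power)

lemma finite_eliminate:
  assumes "finite X"
  shows "finite (eliminate m z X)"
proof (rule finite_subset)
  have "j \<le> weight ((Br z ^^ j) y)" for j y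
  proof (induction j)
    case (Suc j)
    then show ?case by (cases "leaves z") auto
  qed simp
  then have "j \<le> m" if "weight ((Br z ^^ j) y) \<le> m" for j y using that le_trans by blast
  then show "eliminate m z X \<subseteq> (\<lambda>(j, y). (Br z ^^ j) y) ` ({..m} \<times> X)"
    by (auto simp: eliminate_def)
  show "finite ((\<lambda>(j, y). (Br z ^^ j) y) ` ({..m} \<times> X))" using assms by simp
qed

text \<open>The words of leaves of the letters factor uniquely. This makes words of distinct
  letters non-commuting, which is what separates their leading words.\<close>

definition is_code :: "'a bracket set \<Rightarrow> bool" where
  "is_code X \<longleftrightarrow> inj_on (\<lambda>cs. concat (map leaves cs)) (lists X)"

lemma block_factorization_unique:
  assumes "replicate i z @ y # r = replicate j z @ y' # r'" "y \<noteq> z" "y' \<noteq> z"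
  shows "i = j \<and> y = y' \<and> r = r'"
  using assms
proof (induction i arbitrary: j)
  case 0 then show ?case by (cases j) auto
next
  case (Suc i) then show ?case by (cases j) auto
qed

text \<open>A word over the new letters expands to a word over the old ones in which each new letter
  is a block \<open>z \<dots> z y\<close>. The blocks can be recovered, as each of them ends at its only letter
  other than \<open>z\<close>.\<close>

lemma is_code_eliminate:
  assumes X: "is_code X" and z: "z \<in> X"
  shows "is_code (eliminate m z X)"
proof -
  have "\<forall>c\<in>eliminate m z X. \<exists>j y. y \<in> X - {z} \<and> c = (Br z ^^ j) y"
    unfolding eliminate_def by blast
  then obtain p q where p: "\<And>c. c \<in> eliminate m z X \<Longrightarrow> q c \<in> X - {z} \<and> c = (Br z ^^ p c) (q c)"
    by metis
  \<comment> \<open>\<open>rep c\<close> writes a new letter as a block of old ones.\<close>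
  define rep where "rep c = replicate (p c) z @ [q c]" for c
  have rep: "concat (map leaves (rep c)) = leaves c" "rep c \<in> lists X" if "c \<in> eliminate m z X" for c
  proof -
    have "leaves c = leaves ((Br z ^^ p c) (q c))" using p[OF that] by simp
    then show "concat (map leaves (rep c)) = leaves c"
      by (simp add: rep_def leaves_Br_power map_replicate)
    show "rep c \<in> lists X" using p[OF that] z by (auto simp: rep_def)
  qed
  have lift: "concat (map leaves (concat (map rep cs))) = concat (map leaves cs)"
    "concat (map rep cs) \<in> lists X" if "cs \<in> lists (eliminate m z X)" for cs
    using that by (induction cs) (auto simp: rep(1), use rep(2) in blast)
  have uniq: "cs = ds" if "cs \<in> lists (eliminate m z X)" "ds \<in> lists (eliminate m z X)"
    "concat (map rep cs) = concat (map rep ds)" for cs ds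
    using that
  proof (induction cs arbitrary: ds rule: list.induct)
    case Nil then show ?case by (cases ds) (auto simp: rep_def)
  next
    case (Cons c cs)
    obtain d ds' where ds: "ds = d # ds'" using Cons.prems(3) by (cases ds) (auto simp: rep_def)
    have cd: "c \<in> eliminate m z X" "d \<in> eliminate m z X" using Cons.prems ds by auto
    have "p c = p d \<and> q c = q d \<and> concat (map rep cs) = concat (map rep ds')"
      using Cons.prems(3) p[OF cd(1)] p[OF cd(2)]
      by (intro block_factorization_unique[of _ z]) (simp_all add: ds, simp_all add: rep_def)
    moreover from this have "c = d" using p[OF cd(1)] p[OF cd(2)] by metis
    ultimately show ?case using Cons ds by auto
  qed
  show ?thesis unfolding is_code_def
  proof (rule inj_onI)
    fix cs ds assume cd: "cs \<in> lists (eliminate m z X)" "ds \<in> lists (eliminate m z X)"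
      and "concat (map leaves cs) = concat (map leaves ds)"
    then have "concat (map rep cs) = concat (map rep ds)"
      using X lift[OF cd(1)] lift[OF cd(2)] unfolding is_code_def by (metis inj_onD)
    then show "cs = ds" using uniq cd by blast
  qed
qed

lemma is_code_Leaf: "is_code (Leaf ` S)"
proof -
  have "map Leaf (concat (map leaves cs)) = cs" if "cs \<in> lists (Leaf ` S)" for cs
    using that by (induction cs) auto
  then show ?thesis unfolding is_code_def by (rule inj_on_inverseI[of _ "map Leaf"])
qed

section \<open>Leading words of Lie elements\<close>

text \<open>Letters are read as digits, so that the lexicographic comparison of words of equal length
  becomes the comparison of numbers.\<close>

locale digit_alphabet =
  fixes S :: "'a set" and digit :: "'a \<Rightarrow> nat" and base :: nat
  assumes digit_inj: "inj_on digit S" and digit_less: "s \<in> S \<Longrightarrow> digit s < base" and base: "2 \<le> base"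
begin

primrec word_value :: "'a list \<Rightarrow> nat" where
  "word_value [] = 0"
| "word_value (s # w) = digit s * base ^ length w + word_value w"

lemma word_value_append: "word_value (u @ v) = word_value u * base ^ length v + word_value v"
  by (induction u) (auto simp: algebra_simps power_add)

lemma word_value_less: "set w \<subseteq> S \<Longrightarrow> word_value w < base ^ length w"
proof (induction w)
  case (Cons s w)
  then have "word_value (s # w) < digit s * base ^ length w + base ^ length w" by simp
  also have "\<dots> = Suc (digit s) * base ^ length w" by simp
  also have "\<dots> \<le> base * base ^ length w" using digit_less[of s] Cons.prems by (intro mult_right_mono) auto
  finally show ?case by simp
qed simp

lemma word_value_inj:
  assumes "length u = length v" "set u \<subseteq> S" "set v \<subseteq> S" "word_value u = word_value v"
  shows "u = v"
  using assms
proof (induction u v rule: list_induct2)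
  case (Cons s u t v)
  let ?M = "base ^ length u"
  have lt: "word_value u < ?M" "word_value v < ?M"
    using word_value_less[of u] word_value_less[of v] Cons by auto
  have eq: "digit s * ?M + word_value u = digit t * ?M + word_value v" using Cons by simp
  have "0 < ?M" using base by simp
  then have "digit s = (digit s * ?M + word_value u) div ?M" using lt by simp
  also have "\<dots> = digit t" unfolding eq using lt \<open>0 < ?M\<close> by simp
  finally have "digit s = digit t" .
  then show ?case using Cons eq inj_onD[OF digit_inj] by auto
qed simp

text \<open>Comparing \<open>u @ v\<close> with \<open>v @ u\<close> in lexicographic order is a total preorder on nonempty words.
  It is represented by a real number: the value of \<open>0.uuu\<dots>\<close> read in the given base. Transitivity and
  the existence of a least letter are then immediate.\<close>

definition slope :: "'a list \<Rightarrow> real" where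
  "slope w = real (word_value w) / (real base ^ length w - 1)"

lemma base_power_gt_one: "w \<noteq> [] \<Longrightarrow> real base ^ length w > 1"
  using base by (intro one_less_power) auto

lemma slope_mult: "w \<noteq> [] \<Longrightarrow> slope w * (real base ^ length w - 1) = real (word_value w)"
  using base_power_gt_one[of w] by (simp add: slope_def)

lemma slope_less_iff:
  assumes "u \<noteq> []" "v \<noteq> []"
  shows "slope u < slope v \<longleftrightarrow> word_value (u @ v) < word_value (v @ u)"
proof -
  have p: "0 < real base ^ length u - 1" "0 < real base ^ length v - 1"
    using assms base_power_gt_one by fastforce+
  have "slope u < slope v \<longleftrightarrow>
      real (word_value u) * (real base ^ length v - 1) < real (word_value v) * (real base ^ length u - 1)"
    unfolding slope_def pos_divide_less_eq[OF p(1)] times_divide_eq_left pos_less_divide_eq[OF p(2)] ..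
  also have "\<dots> \<longleftrightarrow> real (word_value (u @ v)) < real (word_value (v @ u))"
    by (simp add: word_value_append algebra_simps)
  finally show ?thesis by simp
qed

lemma slope_inj_on_code:
  assumes X: "is_code X" and S: "\<And>x. x \<in> X \<Longrightarrow> set (leaves x) \<subseteq> S"
    and xy: "x \<in> X" "y \<in> X" "slope (leaves x) = slope (leaves y)"
  shows "x = y"
proof -
  let ?u = "leaves x" and ?v = "leaves y"
  have "word_value (?u @ ?v) = word_value (?v @ ?u)"
  proof (rule ccontr)
    assume "word_value (?u @ ?v) \<noteq> word_value (?v @ ?u)"
    then have "slope ?u < slope ?v \<or> slope ?v < slope ?u"
      by (simp add: slope_less_iff nat_neq_iff)
    then show False using xy(3) by simp
  qed
  then have "?u @ ?v = ?v @ ?u"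
  proof (rule word_value_inj[rotated 3])
    show "length (?u @ ?v) = length (?v @ ?u)" by simp
    show "set (?u @ ?v) \<subseteq> S" "set (?v @ ?u) \<subseteq> S" using S[OF xy(1)] S[OF xy(2)] by simp_all
  qed
  then have eq: "concat (map leaves [x, y]) = concat (map leaves [y, x])"
    unfolding list.map concat.simps append_Nil2 .
  have "[x, y] = [y, x]"
    by (rule inj_onD[OF X[unfolded is_code_def] eq]) (use xy in simp_all)
  then show ?thesis by (rule list.inject[THEN iffD1, THEN conjunct1])
qed

text \<open>Words of the same length are compared by \<open>word_value\<close>, i.e. lexicographically. The least
  word in the Lie polynomial is the word of leaves, with coefficient \<open>1\<close>.\<close>

definition has_leading_word :: "'a bracket \<Rightarrow> bool" where
  "has_leading_word c \<longleftrightarrow> coeff (lie_series c) (leaves c) = 1 \<and>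
    (\<forall>w. coeff (lie_series c) w \<noteq> 0 \<longrightarrow> length w = weight c \<and> word_value (leaves c) \<le> word_value w)"

lemma
  assumes "has_leading_word c"
  shows coeff_leading_word: "coeff (lie_series c) (leaves c) = 1"
    and length_lie_series: "coeff (lie_series c) w \<noteq> 0 \<Longrightarrow> length w = weight c"
    and leading_word_le: "coeff (lie_series c) w \<noteq> 0 \<Longrightarrow> word_value (leaves c) \<le> word_value w"
  using assms unfolding has_leading_word_def by blast+

lemma has_leading_word_Leaf: "has_leading_word (Leaf s)"
  by (simp add: has_leading_word_def coeff_var)

lemma has_leading_word_prod:
  assumes a: "has_leading_word a" and b: "has_leading_word b"
  shows "coeff (lie_series a * lie_series b) (leaves a @ leaves b) = 1"
    and "coeff (lie_series a * lie_series b) w \<noteq> 0 \<Longrightarrow>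
      length w = weight a + weight b \<and> word_value (leaves a @ leaves b) \<le> word_value w"
proof -
  let ?w = "leaves a @ leaves b"
  have z: "coeff (lie_series a) (take i ?w) = 0" if "i \<le> length ?w" "i \<noteq> weight a" for i
  proof -
    have "length (take i ?w) \<noteq> weight a" using that by (simp del: take_append)
    then show ?thesis using length_lie_series[OF a] by blast
  qed
  have "coeff (lie_series a * lie_series b) ?w = (\<Sum>i\<le>length ?w. if i = weight a then 1 else 0)"
    unfolding coeff_mult
  proof (rule sum.cong[OF refl])
    fix i assume i: "i \<in> {..length ?w}"
    show "coeff (lie_series a) (take i ?w) * coeff (lie_series b) (drop i ?w) = (if i = weight a then 1 else 0)"
    proof (cases "i = weight a")
      case True
      then show ?thesis by (simp add: coeff_leading_word a b)
    next
      case False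
      then show ?thesis using z[of i] i by (simp del: take_append)
    qed
  qed
  then show "coeff (lie_series a * lie_series b) ?w = 1" by simp
  assume "coeff (lie_series a * lie_series b) w \<noteq> 0"
  then obtain u v where uv: "w = u @ v" "coeff (lie_series a) u \<noteq> 0" "coeff (lie_series b) v \<noteq> 0"
    by (rule coeff_mult_nonzeroE)
  have u: "length u = weight a" "word_value (leaves a) \<le> word_value u"
    and v: "length v = weight b" "word_value (leaves b) \<le> word_value v"
    using length_lie_series[OF a uv(2)] leading_word_le[OF a uv(2)]
      length_lie_series[OF b uv(3)] leading_word_le[OF b uv(3)] by blast+
  show "length w = weight a + weight b \<and> word_value ?w \<le> word_value w"
    using u v by (simp add: uv(1) word_value_append add_mono)
qed

text \<open>The least words of the two products are \<open>leaves a @ leaves b\<close> and \<open>leaves b @ leaves a\<close>, and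
  the assumption on slopes says that the first one is smaller.\<close>

lemma has_leading_word_Br:
  assumes a: "has_leading_word a" and b: "has_leading_word b"
    and less: "slope (leaves a) < slope (leaves b)"
  shows "has_leading_word (Br a b)"
proof -
  have lt: "word_value (leaves a @ leaves b) < word_value (leaves b @ leaves a)"
    using less by (simp add: slope_less_iff)
  have "coeff (lie_series b * lie_series a) (leaves a @ leaves b) = 0"
    using has_leading_word_prod(2)[OF b a, of "leaves a @ leaves b"] lt by linarith
  then have 1: "coeff (lie_series (Br a b)) (leaves (Br a b)) = 1"
    by (simp add: has_leading_word_prod(1)[OF a b])
  have "length w = weight a + weight b \<and> word_value (leaves a @ leaves b) \<le> word_value w"
    if "coeff (lie_series (Br a b)) w \<noteq> 0" for w
  proof -
    from that consider "coeff (lie_series a * lie_series b) w \<noteq> 0" | "coeff (lie_series b * lie_series a) w \<noteq> 0"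
      by (cases "coeff (lie_series a * lie_series b) w = 0") auto
    then show ?thesis
      using has_leading_word_prod(2)[OF a b, of w] has_leading_word_prod(2)[OF b a, of w] lt by cases auto
  qed
  with 1 show ?thesis unfolding has_leading_word_def by simp
qed

lemma eliminate_leading:
  assumes z: "has_leading_word z" and y: "has_leading_word y" and less: "slope (leaves z) < slope (leaves y)"
  shows "has_leading_word ((Br z ^^ j) y) \<and> slope (leaves z) < slope (leaves ((Br z ^^ j) y))"
proof (induction j)
  case (Suc j)
  let ?c = "(Br z ^^ j) y"
  have "slope (leaves z) < slope (leaves z @ leaves ?c)"
    using Suc by (simp add: slope_less_iff word_value_append algebra_simps power_add)
  then show ?case using has_leading_word_Br[OF z, of ?c] Suc by simp
qed (use assms in simp)

text \<open>Series all of whose words have slope greater than \<open>r\<close>. The condition is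
  written without division, so that it excludes the empty word. Since the slope of a
  concatenation lies between the slopes of the two parts, these series form a subring without unit, and membership passes
  from letters to all Lie polynomials in them.\<close>

definition above_slope :: "real \<Rightarrow> 'a series set" where
  "above_slope r = {f. \<forall>w. coeff f w \<noteq> 0 \<longrightarrow> r * (real base ^ length w - 1) < real (word_value w)}"

lemma above_slope_diff: "f \<in> above_slope r \<Longrightarrow> g \<in> above_slope r \<Longrightarrow> f - g \<in> above_slope r"
  by (auto simp: above_slope_def) (metis diff_zero)

lemma above_slope_mult:
  assumes "f \<in> above_slope r" "g \<in> above_slope r"
  shows "f * g \<in> above_slope r"
  unfolding above_slope_def
proof (intro CollectI allI impI)
  fix w assume "coeff (f * g) w \<noteq> 0"
  then obtain u v where w: "w = u @ v" and "coeff f u \<noteq> 0" "coeff g v \<noteq> 0" by (rule coeff_mult_nonzeroE)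
  then have u: "r * (real base ^ length u - 1) < real (word_value u)"
    and v: "r * (real base ^ length v - 1) < real (word_value v)"
    using assms by (auto simp: above_slope_def)
  have "r * (real base ^ length w - 1)
    = (r * (real base ^ length u - 1)) * real base ^ length v + r * (real base ^ length v - 1)"
    by (simp add: w algebra_simps power_add)
  also have "\<dots> < real (word_value u) * real base ^ length v + real (word_value v)"
    using u v base by (intro add_strict_mono mult_strict_right_mono) auto
  finally show "r * (real base ^ length w - 1) < real (word_value w)"
    by (simp add: w word_value_append)
qed

lemma lie_series_above_slope:
  assumes "has_leading_word c" "r < slope (leaves c)"
  shows "lie_series c \<in> above_slope r"
  unfolding above_slope_def
proof (intro CollectI allI impI)
  fix w assume "coeff (lie_series c) w \<noteq> 0"
  then have w: "length w = weight c" "word_value (leaves c) \<le> word_value w"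
    using length_lie_series leading_word_le assms(1) by blast+
  have "r * (real base ^ weight c - 1) < slope (leaves c) * (real base ^ weight c - 1)"
    using assms base_power_gt_one[of "leaves c"] by (intro mult_strict_right_mono) auto
  then show "r * (real base ^ length w - 1) < real (word_value w)"
    using w by (simp add: slope_mult)
qed

lemma brackets_over_above_slope:
  assumes "c \<in> brackets_over X" "\<And>x. x \<in> X \<Longrightarrow> lie_series x \<in> above_slope r"
  shows "lie_series c \<in> above_slope r"
  using assms by (induction rule: brackets_over.induct) (auto intro: above_slope_diff above_slope_mult)

end

section \<open>Elimination in the lower central series\<close>

context group
begin

text \<open>Conjugation changes an element of \<open>N\<close> by a commutator, which lies in the next term.\<close>

lemma normal_between_lower_central:
  assumes N: "subgroup N G" "N \<subseteq> lower_central G j" "lower_central G (Suc j) \<subseteq> N"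
  shows "N \<lhd> G"
  unfolding normal_inv_iff
proof (intro conjI N(1) ballI)
  fix g x assume g: "g \<in> carrier G" and x: "x \<in> N"
  then have xc: "x \<in> carrier G" using subgroup.mem_carrier[OF N(1)] by simp
  have "comm g x \<in> N"
    unfolding comm_def by (rule subsetD[OF N(3) commutator_in_lower_central[OF g subsetD[OF N(2) x]]])
  then have "comm g x \<otimes> x \<in> N" using x by (rule subgroup.m_closed[OF N(1)])
  then show "g \<otimes> x \<otimes> inv g \<in> N" using g xc by (simp add: group_normalize)
qed

lemma comm_inv_mem:
  assumes "N \<lhd> G" "x \<in> carrier G" "y \<in> carrier G" "comm x y \<in> N"
  shows "comm x (inv y) \<in> N" "comm (inv x) y \<in> N"
proof -
  have *: "comm a (inv b) \<in> N" if "a \<in> carrier G" "b \<in> carrier G" "comm a b \<in> N" for a b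
    using subgroup.m_inv_closed[OF subgroup_commuting_mod[OF assms(1) that(1)], of b] that by simp
  note swap = comm_swap_mem[OF normal_imp_subgroup[OF assms(1)]]
  show "comm x (inv y) \<in> N" by (rule *[OF assms(2-4)])
  show "comm (inv x) y \<in> N"
    by (rule swap[OF assms(3) _ *[OF assms(3,2) swap[OF assms(2-4)]]]) (simp add: assms)
qed

primrec group_bracket :: "'a bracket \<Rightarrow> 'a" where
  "group_bracket (Leaf s) = s"
| "group_bracket (Br a b) = comm (group_bracket a) (group_bracket b)"

lemma group_bracket_closed: "set (leaves c) \<subseteq> carrier G \<Longrightarrow> group_bracket c \<in> carrier G"
  by (induction c) auto

lemma group_bracket_lower_central:
  "set (leaves c) \<subseteq> carrier G \<Longrightarrow> group_bracket c \<in> lower_central G (weight c - 1)"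
proof (induction c)
  case (Br a b)
  then have "comm (group_bracket a) (group_bracket b) \<in> lower_central G (Suc (weight a - 1 + (weight b - 1)))"
    by (intro comm_lower_central) auto
  moreover have "Suc (weight a - 1 + (weight b - 1)) = weight (Br a b) - 1"
    by (cases "leaves a"; cases "leaves b") auto
  ultimately show ?case by (simp only: group_bracket.simps)
qed simp

text \<open>In the associated graded Lie ring of the lower central series, these elements of the
  group represent the brackets of weight \<open>d\<close> over \<open>X\<close>; the subgroup \<open>bracket_span X d\<close> is the full
  preimage of the subgroup which they span in degree \<open>d\<close>.\<close>

definition span_gens :: "'a bracket set \<Rightarrow> nat \<Rightarrow> 'a set" where
  "span_gens X d = lower_central G d \<union> group_bracket ` {c \<in> brackets_over X. weight c = d}"

definition bracket_span :: "'a bracket set \<Rightarrow> nat \<Rightarrow> 'a set" where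
  "bracket_span X d = generate G (span_gens X d)"

end

locale bracket_alphabet = group G for G (structure) +
  fixes X :: "'a bracket set"
  assumes leaves_closed: "x \<in> X \<Longrightarrow> set (leaves x) \<subseteq> carrier G"
begin

lemma leaves_brackets_closed: "c \<in> brackets_over X \<Longrightarrow> set (leaves c) \<subseteq> carrier G"
  using leaves_brackets_over leaves_closed by blast

lemma bracket_closed: "c \<in> brackets_over X \<Longrightarrow> group_bracket c \<in> carrier G"
  by (simp add: group_bracket_closed leaves_brackets_closed)

lemma span_gens_subset: "span_gens X d \<subseteq> lower_central G (d - 1)"
  using lower_central_antimono[of "d - 1" d] group_bracket_lower_central[OF leaves_brackets_closed]
  by (auto simp: span_gens_def)

lemma span_gens_closed: "span_gens X d \<subseteq> carrier G"
  using span_gens_subset lower_central_carrier by blast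

lemma bracket_span_subset: "bracket_span X d \<subseteq> lower_central G (d - 1)"
  unfolding bracket_span_def by (intro generate_subgroup_incl lower_central_subgroup span_gens_subset)

lemma bracket_span_closed: "bracket_span X d \<subseteq> carrier G"
  using bracket_span_subset lower_central_carrier by blast

lemma subgroup_bracket_span: "subgroup (bracket_span X d) G"
  unfolding bracket_span_def by (intro generate_is_subgroup span_gens_closed)

lemma lower_central_subset_bracket_span: "lower_central G d \<subseteq> bracket_span X d"
  unfolding bracket_span_def by (auto simp: span_gens_def intro: generate.incl)

lemma bracket_in_span: "c \<in> brackets_over X \<Longrightarrow> weight c = d \<Longrightarrow> group_bracket c \<in> bracket_span X d"
  unfolding bracket_span_def by (auto simp: span_gens_def intro: generate.incl)

lemma normal_bracket_span: "0 < d \<Longrightarrow> bracket_span X d \<lhd> G"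
  using normal_between_lower_central[OF subgroup_bracket_span, of d "d - 1"]
    bracket_span_subset lower_central_subset_bracket_span by simp

lemma comm_lower_central_mem_span:
  assumes "0 < d" "0 < e" "a \<in> lower_central G d" "b \<in> lower_central G (e - 1)"
  shows "comm a b \<in> bracket_span X (d + e)" "comm b a \<in> bracket_span X (d + e)"
proof -
  have "comm a b \<in> lower_central G (d + e)" "comm b a \<in> lower_central G (d + e)"
    using comm_lower_central[OF assms(3,4)] comm_lower_central[OF assms(4,3)] assms(1,2)
    by (simp_all add: add.commute)
  then show "comm a b \<in> bracket_span X (d + e)" "comm b a \<in> bracket_span X (d + e)"
    using lower_central_subset_bracket_span by auto
qed

lemma comm_span_gens:
  assumes "0 < d" "0 < e" "a \<in> span_gens X d" "b \<in> span_gens X e"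
  shows "comm a b \<in> bracket_span X (d + e)"
proof -
  consider "a \<in> lower_central G d" | "b \<in> lower_central G e"
    | a' b' where "a' \<in> brackets_over X" "b' \<in> brackets_over X" "weight a' = d" "weight b' = e"
      "a = group_bracket a'" "b = group_bracket b'"
    using assms(3,4) by (auto simp: span_gens_def)
  then show ?thesis
  proof cases
    case 1
    then show ?thesis using comm_lower_central_mem_span(1)[of d e a b] assms span_gens_subset by blast
  next
    case 2
    then show ?thesis
      using comm_lower_central_mem_span(2)[of e d b a] assms span_gens_subset by (auto simp: add.commute)
  next
    case 3
    then show ?thesis using bracket_in_span[of "Br a' b'"] by (auto intro: brackets_over.bracket)
  qed
qed

text \<open>The brackets over \<open>X\<close> span a Lie subring.\<close>

lemma comm_bracket_span:
  assumes "0 < d" "0 < e" "a \<in> bracket_span X d" "b \<in> bracket_span X e"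
  shows "comm a b \<in> bracket_span X (d + e)"
proof (rule comm_generate_mem[OF _ span_gens_closed span_gens_closed])
  show "bracket_span X (d + e) \<lhd> G" using assms by (intro normal_bracket_span) simp
  show "a \<in> generate G (span_gens X d)" "b \<in> generate G (span_gens X e)"
    using assms by (simp_all add: bracket_span_def)
qed (rule comm_span_gens[OF assms(1,2)])

end

locale elimination_step = bracket_alphabet +
  fixes z :: "'a bracket" and m :: nat
  assumes pivot: "z \<in> X"
begin

sublocale elim: bracket_alphabet G "eliminate m z X"
  by unfold_locales (rule eliminate_leaves[OF leaves_closed pivot])

abbreviation "Y \<equiv> eliminate m z X"

lemma pivot_closed: "group_bracket z \<in> carrier G"
  by (simp add: group_bracket_closed leaves_closed pivot)

text \<open>Bracketing with \<open>z\<close> is a derivation that sends each new letter \<open>[z,\<dots>[z,y]]\<close> to another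
  one. It therefore preserves the Lie subring generated by the new letters.\<close>

lemma comm_pivot_bracket:
  assumes "c \<in> brackets_over Y" "weight z + weight c \<le> m"
  shows "comm (group_bracket z) (group_bracket c) \<in> bracket_span Y (weight z + weight c)"
  using assms
proof (induction rule: brackets_over.induct)
  case (base c)
  then obtain j y where "y \<in> X - {z}" "c = (Br z ^^ j) y" by (auto simp: eliminate_def)
  then have "y \<in> X - {z}" "Br z c = (Br z ^^ Suc j) y" by auto
  then have "Br z c \<in> Y" using base unfolding eliminate_def by fastforce
  then show ?case using elim.bracket_in_span[of "Br z c"] brackets_over.base by fastforce
next
  case (bracket a b)
  let ?z = "group_bracket z" and ?a = "group_bracket a" and ?b = "group_bracket b"
  let ?N = "bracket_span Y (weight z + weight a + weight b)"
  have c: "?z \<in> carrier G" "?a \<in> carrier G" "?b \<in> carrier G"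
    using pivot_closed bracket elim.bracket_closed by auto
  have za: "comm ?z ?a \<in> bracket_span Y (weight z + weight a)"
    and zb: "comm ?z ?b \<in> bracket_span Y (weight z + weight b)"
    using bracket by auto
  have n: "bracket_span Y (weight z + weight a) \<lhd> G" "bracket_span Y (weight z + weight b) \<lhd> G"
    by (rule elim.normal_bracket_span, simp)+
  have zb': "comm (inv ?b) ?z \<in> bracket_span Y (weight z + weight b)"
    using c by (intro comm_inv_mem[OF n(2)] comm_swap_mem[OF normal_imp_subgroup[OF n(2)] _ _ zb]) auto
  have za': "comm (inv ?z) (inv ?a) \<in> bracket_span Y (weight z + weight a)"
    using c by (intro comm_inv_mem[OF n(1)] za) auto
  have ia: "inv ?a \<in> bracket_span Y (weight a)" and b: "?b \<in> bracket_span Y (weight b)"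
    using bracket.hyps by (auto intro: subgroup.m_inv_closed[OF elim.subgroup_bracket_span] elim.bracket_in_span)
  \<comment> \<open>The Jacobi identity writes \<open>[z, [a, b]]\<close> by means of \<open>[a, [b, z]]\<close> and \<open>[b, [z, a]]\<close>.\<close>
  have "comm ?z (comm ?a ?b) \<in> ?N"
  proof (rule hall_witt_mem)
    show "?N \<lhd> G" by (rule elim.normal_bracket_span) simp
    show "comm (inv ?a) (comm (inv ?b) ?z) \<in> ?N"
      using elim.comm_bracket_span[OF _ _ ia zb'] by (simp add: ac_simps)
    show "comm ?b (comm (inv ?z) (inv ?a)) \<in> ?N"
      using elim.comm_bracket_span[OF _ _ b za'] by (simp add: ac_simps)
  qed (use c in auto)
  then show ?case by (simp add: ac_simps)
qed

text \<open>Generators of the sum of the Lie subring over the new letters and the line through \<open>z\<close>.\<close>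

definition pivot_gens :: "nat \<Rightarrow> 'a set" where
  "pivot_gens d = span_gens Y d \<union> {g. g = group_bracket z \<and> weight z = d}"

text \<open>The sum of the line through \<open>z\<close> and the subring over the new letters is closed under
  brackets, and its brackets even lie in the second summand, because \<open>[z, z] = 0\<close>.\<close>

lemma comm_pivot_gens:
  assumes "0 < d" "0 < e" "d + e \<le> m" "a \<in> pivot_gens d" "b \<in> pivot_gens e"
  shows "comm a b \<in> bracket_span Y (d + e)"
proof -
  note N = elim.subgroup_bracket_span
  have z: "comm (group_bracket z) b \<in> bracket_span Y (weight z + e)"
    if "0 < e" "weight z + e \<le> m" "b \<in> span_gens Y e" for b e
    using that(3) unfolding span_gens_def
  proof
    assume "b \<in> lower_central G e"
    then show ?thesis
      using elim.comm_lower_central_mem_span(2)[of e "weight z" b "group_bracket z"] that(1)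
        group_bracket_lower_central[OF leaves_closed[OF pivot]] by (auto simp: add.commute)
  qed (use that(2) comm_pivot_bracket in auto)
  consider "a \<in> span_gens Y d" "b \<in> span_gens Y e"
    | "a = group_bracket z" "weight z = d" "b \<in> span_gens Y e"
    | "a \<in> span_gens Y d" "b = group_bracket z" "weight z = e"
    | "a = group_bracket z" "b = group_bracket z"
    using assms(4,5) by (auto simp: pivot_gens_def)
  then show ?thesis
  proof cases
    case 1 then show ?thesis using assms(1,2) by (intro elim.comm_span_gens)
  next
    case 2 then show ?thesis using z[of e b] assms(2,3) by simp
  next
    case 3
    have "comm (group_bracket z) a \<in> bracket_span Y (d + e)"
      using z[of d a] 3 assms(1,3) by (simp add: add.commute)
    moreover have "a \<in> carrier G" using 3(1) elim.span_gens_closed by blast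
    ultimately show ?thesis
      unfolding 3(2) by (intro comm_swap_mem[OF N pivot_closed])
  next
    case 4
    have "comm (group_bracket z) (group_bracket z) = \<one>" using pivot_closed by (simp add: group_normalize)
    then show ?thesis using subgroup.one_closed[OF N] by (simp only: 4)
  qed
qed

lemma pivot_gens_closed: "pivot_gens d \<subseteq> carrier G"
  using elim.span_gens_closed pivot_closed by (auto simp: pivot_gens_def)

lemma bracket_in_pivot_span:
  assumes "c \<in> brackets_over X" "weight c \<le> m"
  shows "group_bracket c \<in> generate G (pivot_gens (weight c))"
  using assms
proof (induction rule: brackets_over.induct)
  case (base c)
  show ?case
  proof (cases "c = z")
    case False
    have "c = (Br z ^^ 0) c" by simp
    then have "c \<in> Y" using False base unfolding eliminate_def by blast
    then show ?thesis
      by (auto simp: pivot_gens_def span_gens_def intro!: generate.incl brackets_over.base)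
  qed (auto simp: pivot_gens_def intro: generate.incl)
next
  case (bracket a b)
  have "comm (group_bracket a) (group_bracket b) \<in> bracket_span Y (weight a + weight b)"
  proof (rule comm_generate_mem[OF _ pivot_gens_closed pivot_gens_closed])
    show "bracket_span Y (weight a + weight b) \<lhd> G" by (rule elim.normal_bracket_span) simp
    show "group_bracket a \<in> generate G (pivot_gens (weight a))"
      "group_bracket b \<in> generate G (pivot_gens (weight b))" using bracket by simp_all
  qed (rule comm_pivot_gens, use bracket.prems in auto)
  also have "\<dots> \<subseteq> generate G (pivot_gens (weight a + weight b))"
    unfolding bracket_span_def by (intro mono_generate) (auto simp: pivot_gens_def)
  finally show ?case by simp
qed

lemma bracket_span_pivot:
  assumes "g \<in> bracket_span X m"
  shows "g \<in> generate G (pivot_gens m)"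
proof -
  have "span_gens X m \<subseteq> generate G (pivot_gens m)"
  proof
    fix g assume "g \<in> span_gens X m"
    then show "g \<in> generate G (pivot_gens m)"
      using bracket_in_pivot_span by (auto simp: span_gens_def pivot_gens_def intro: generate.incl)
  qed
  then show ?thesis
    using assms unfolding bracket_span_def
    by (meson generate_subgroup_incl generate_is_subgroup pivot_gens_closed subsetD)
qed

text \<open>In weights other than that of \<open>z\<close> the elimination loses nothing, and in the weight of
  \<open>z\<close> it loses just the powers of \<open>z\<close>, by the next lemma.\<close>

lemma bracket_span_eliminate_other:
  assumes "g \<in> bracket_span X m" "weight z \<noteq> m"
  shows "g \<in> bracket_span Y m"
  using bracket_span_pivot[OF assms(1)] assms(2) by (simp add: pivot_gens_def bracket_span_def)

lemma bracket_span_eliminate: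
  assumes g: "g \<in> bracket_span X m" and m: "weight z = m"
  obtains h and i :: int where "h \<in> bracket_span Y m" "g = h \<otimes> group_bracket z [^] i"
proof -
  let ?N = "bracket_span Y m" and ?Z = "generate G {group_bracket z}"
  have "0 < m" using weight_pos[of z] m by simp
  then have sub: "subgroup (?N <#> ?Z) G"
    using pivot_closed by (intro mult_norm_subgroup elim.normal_bracket_span generate_is_subgroup) auto
  have "x \<in> ?N <#> ?Z" if "x \<in> pivot_gens m" for x
  proof -
    from that consider "x \<in> span_gens Y m" | "x = group_bracket z" by (auto simp: pivot_gens_def)
    then show ?thesis
    proof cases
      case 1
      then have "x \<in> ?N" "x = x \<otimes> \<one>"
        using subsetD[OF elim.span_gens_closed 1] by (auto simp: bracket_span_def intro: generate.incl)
      then show ?thesis unfolding set_mult_def using generate.one by blast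
    next
      case 2
      then have "x = \<one> \<otimes> x" "x \<in> ?Z" using pivot_closed by (auto intro: generate.incl)
      then show ?thesis unfolding set_mult_def using subgroup.one_closed[OF elim.subgroup_bracket_span] by blast
    qed
  qed
  then have "generate G (pivot_gens m) \<subseteq> ?N <#> ?Z" by (intro generate_subgroup_incl sub) blast
  then have "g \<in> ?N <#> ?Z" using bracket_span_pivot[OF g] by blast
  then obtain h y where h: "h \<in> ?N" "y \<in> ?Z" "g = h \<otimes> y" by (auto simp: set_mult_def)
  then obtain i :: int where "y = group_bracket z [^] i"
    using generate_pow[OF pivot_closed] by blast
  then show ?thesis using that h by blast
qed

end

section \<open>The lower central series is detected by the Magnus expansion\<close>

context free_group_on_basis
begin

text \<open>On the elements whose expansion starts in degree \<open>length w\<close> or later, the coefficient of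
  \<open>w\<close> is a homomorphism to the integers.\<close>

lemma coeff_magnus_mult:
  assumes "g \<in> dimension_subgroup (length w)" "h \<in> dimension_subgroup (length w)" "w \<noteq> []"
  shows "coeff (magnus (g \<otimes> h)) w = coeff (magnus g) w + coeff (magnus h) w"
proof -
  have "(magnus (g \<otimes> h) - 1) - ((magnus g - 1) + (magnus h - 1)) \<in> order_ideal (length w + length w)"
    using assms(1,2) by (rule magnus_mult_mod)
  moreover have "length w < length w + length w" using assms(3) by simp
  ultimately have "coeff ((magnus (g \<otimes> h) - 1) - ((magnus g - 1) + (magnus h - 1))) w = 0"
    unfolding order_ideal_def by blast
  then show ?thesis using assms(3) by (simp add: coeff_one)
qed

lemma coeff_magnus_inv:
  assumes "g \<in> dimension_subgroup (length w)" "w \<noteq> []"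
  shows "coeff (magnus (inv g)) w = - coeff (magnus g) w"
proof -
  have "g \<in> carrier G" using assms by (simp add: dimension_subgroup_def)
  then have "coeff (magnus (g \<otimes> inv g)) w = 0" using assms(2) by (simp add: magnus_one coeff_one)
  then show ?thesis
    using coeff_magnus_mult[OF assms(1) subgroup.m_inv_closed[OF subgroup_dimension_subgroup assms(1)] assms(2)]
    by simp
qed

lemma coeff_magnus_pow:
  fixes i :: int
  assumes g: "g \<in> dimension_subgroup (length w)" and w: "w \<noteq> []"
  shows "g [^] i \<in> dimension_subgroup (length w) \<and> coeff (magnus (g [^] i)) w = i * coeff (magnus g) w"
proof -
  note D = subgroup_dimension_subgroup[of "length w"]
  have gc: "g \<in> carrier G" using g by (simp add: dimension_subgroup_def)
  have nat: "g [^] n \<in> dimension_subgroup (length w) \<and> coeff (magnus (g [^] n)) w = int n * coeff (magnus g) w"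
    for n :: nat
  proof (induction n)
    case 0
    then show ?case using subgroup.one_closed[OF D] w by (simp add: magnus_one coeff_one)
  next
    case (Suc n)
    then show ?case
      using subgroup.m_closed[OF D _ g] coeff_magnus_mult[OF _ g w] by (simp add: algebra_simps)
  qed
  show ?thesis
  proof (cases i)
    case (nonneg n)
    then show ?thesis using nat[of n] by (simp add: int_pow_int)
  next
    case (neg n)
    then have "g [^] i = inv (g [^] Suc n)" using gc by (simp only: int_pow_neg_int)
    then show ?thesis
      using nat[of "Suc n"] coeff_magnus_inv[of "g [^] Suc n" w] w subgroup.m_inv_closed[OF D] neg
      by (simp del: nat_pow_Suc of_nat_Suc)
  qed
qed

lemma subgroup_coeff_magnus_zero:
  assumes "w \<noteq> []"
  shows "subgroup {g \<in> dimension_subgroup (length w). coeff (magnus g) w = 0} G"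
proof (rule subgroupI)
  note D = subgroup_dimension_subgroup[of "length w"]
  show "{g \<in> dimension_subgroup (length w). coeff (magnus g) w = 0} \<subseteq> carrier G"
    using subgroup.subset[OF D] by blast
  show "{g \<in> dimension_subgroup (length w). coeff (magnus g) w = 0} \<noteq> {}"
    using subgroup.one_closed[OF D] assms by (auto simp: magnus_one coeff_one intro!: exI[of _ \<one>])
qed (use assms in \<open>auto simp: coeff_magnus_mult coeff_magnus_inv
      intro: subgroup.m_closed[OF subgroup_dimension_subgroup] subgroup.m_inv_closed[OF subgroup_dimension_subgroup]\<close>)

lemma magnus_group_bracket:
  assumes "set (leaves c) \<subseteq> S"
  shows "lie_series c \<in> order_ideal (weight c) \<and>
    group_bracket c \<in> dimension_subgroup (weight c) \<and>
    magnus (group_bracket c) - 1 - lie_series c \<in> order_ideal (Suc (weight c))"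
  using assms
proof (induction c)
  case (Leaf s)
  then show ?case
    using magnus_minus_one[OF basis_closed, of s]
    by (simp add: magnus_basis dimension_subgroup_def basis_closed order_ideal_zero)
next
  case (Br a b)
  then have a: "lie_series a \<in> order_ideal (weight a)" "group_bracket a \<in> dimension_subgroup (weight a)"
      "magnus (group_bracket a) - 1 - lie_series a \<in> order_ideal (Suc (weight a))"
    and b: "lie_series b \<in> order_ideal (weight b)" "group_bracket b \<in> dimension_subgroup (weight b)"
      "magnus (group_bracket b) - 1 - lie_series b \<in> order_ideal (Suc (weight b))"
    by auto
  have "lie_series (Br a b) \<in> order_ideal (weight (Br a b))"
    using order_ideal_mult[OF a(1) b(1)] order_ideal_mult[OF b(1) a(1)]
    by (simp add: order_ideal_diff add.commute)
  then show ?case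
    using comm_dimension_subgroup[OF a(2) b(2)] magnus_comm_mod[OF a(2,3,1) b(2,3,1)] by simp
qed

lemma coeff_magnus_group_bracket:
  assumes "set (leaves c) \<subseteq> S" "length w = weight c"
  shows "coeff (magnus (group_bracket c)) w = coeff (lie_series c) w"
proof -
  have "coeff (magnus (group_bracket c) - 1 - lie_series c) w = 0"
    using magnus_group_bracket[OF assms(1)] assms(2) unfolding order_ideal_def by simp
  moreover have "w \<noteq> []" using assms(2) by auto
  ultimately show ?thesis by (simp add: coeff_one)
qed

text \<open>The start of the elimination: with the basis as alphabet, brackets span everything.\<close>

lemma lower_central_subset_span_of_basis:
  assumes "0 < d"
  shows "lower_central G (d - 1) \<subseteq> bracket_span (Leaf ` S) d"
proof -
  interpret B: bracket_alphabet G "Leaf ` S"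
    by unfold_locales (auto simp: basis_closed)
  note N = B.subgroup_bracket_span
  have one: "carrier G \<subseteq> bracket_span (Leaf ` S) 1"
  proof
    fix g assume "g \<in> carrier G"
    then show "g \<in> bracket_span (Leaf ` S) 1"
    proof (induction rule: free_induct)
      case one show ?case by (rule subgroup.one_closed[OF N])
    next
      case (letter s g)
      then have "s \<in> bracket_span (Leaf ` S) 1"
        using B.bracket_in_span[of "Leaf s" 1] by (simp add: brackets_over.base)
      then show ?case using letter by (intro subgroup.m_closed[OF N])
    next
      case (inv_letter s g)
      then have "s \<in> bracket_span (Leaf ` S) 1"
        using B.bracket_in_span[of "Leaf s" 1] by (simp add: brackets_over.base)
      then show ?case using inv_letter by (intro subgroup.m_closed[OF N] subgroup.m_inv_closed[OF N])
    qed
  qed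
  have "lower_central G n \<subseteq> bracket_span (Leaf ` S) (Suc n)" for n
  proof (induction n)
    case 0 then show ?case using one by simp
  next
    case (Suc n)
    have "comm a b \<in> bracket_span (Leaf ` S) (Suc (Suc n))" if "a \<in> carrier G" "b \<in> lower_central G n" for a b
      using B.comm_bracket_span[of 1 "Suc n" a b] that one Suc by auto
    then show ?case
      unfolding lower_central.simps(2)[of G n] commutator_subgroup_def
      by (intro generate_subgroup_incl N) (auto simp flip: comm_def)
  qed
  from this[of "d - 1"] show ?thesis using assms by simp
qed

text \<open>The elimination itself. The pivot \<open>z\<close> is a letter of least slope. All new letters have
  greater slope, so that the coefficient of the word \<open>leaves z\<close> vanishes on the span of
  the new letters, while it is \<open>1\<close> on \<open>z\<close>. An element of the given dimension subgroup thus belongs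
  to the span of the new letters alone. The process ends because the least slope increases in each step, among
  the finitely many slopes of words of length at most \<open>m\<close>.\<close>

lemma bracket_span_inter_dimension_subgroup:
  assumes "digit_alphabet S digit base"
    and "finite X" "is_code X" "0 < m"
    and "\<And>x. x \<in> X \<Longrightarrow> set (leaves x) \<subseteq> S \<and> weight x \<le> m \<and> digit_alphabet.has_leading_word digit base x"
    and "g \<in> bracket_span X m" "g \<in> dimension_subgroup (Suc m)"
  shows "g \<in> lower_central G m"
  using assms(2-)
proof (induction "card {w. set w \<subseteq> S \<and> length w \<le> m \<and>
    (\<exists>x\<in>X. digit_alphabet.slope digit base (leaves x) \<le> digit_alphabet.slope digit base w)}"
    arbitrary: X rule: less_induct)
  case less
  interpret digit_alphabet S digit base by fact
  let ?W = "\<lambda>X. {w. set w \<subseteq> S \<and> length w \<le> m \<and> (\<exists>x\<in>X. slope (leaves x) \<le> slope w)}"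
  have X: "set (leaves x) \<subseteq> S" "weight x \<le> m" "has_leading_word x" if "x \<in> X" for x
    using less.prems(4)[OF that] by auto
  show ?case
  proof (cases "X = {}")
    case True
    then have "bracket_span X m = generate G (lower_central G m)"
      by (simp add: bracket_span_def span_gens_def brackets_over_empty)
    also have "\<dots> = lower_central G m"
      using generate_subgroup_incl[OF order_refl lower_central_subgroup[of m]] by (auto intro: generate.incl)
    finally show ?thesis using less.prems by blast
  next
    case False
    then obtain z where z: "z \<in> X" and min: "\<And>x. x \<in> X \<Longrightarrow> slope (leaves z) \<le> slope (leaves x)"
      using ex_min_if_finite[of "(slope \<circ> leaves) ` X"] less.prems(1) by (fastforce simp: not_less)
    let ?Y = "eliminate m z X"
    have less_slope: "slope (leaves z) < slope (leaves y)" if "y \<in> X - {z}" for y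
      using min[of y] slope_inj_on_code[OF less.prems(2) X(1) z, of y] that by force
    have Y: "has_leading_word c" "slope (leaves z) < slope (leaves c)" "weight c \<le> m" "set (leaves c) \<subseteq> S"
      if c: "c \<in> ?Y" for c
    proof -
      obtain j y where y: "y \<in> X - {z}" "c = (Br z ^^ j) y" using c by (auto simp: eliminate_def)
      show "has_leading_word c" "slope (leaves z) < slope (leaves c)"
        using eliminate_leading[OF X(3)[OF z] _ less_slope[OF y(1)], of j] X(3) y by auto
      show "weight c \<le> m" using c by (simp add: eliminate_def)
      show "set (leaves c) \<subseteq> S" using eliminate_leaves[OF X(1) z c] .
    qed
    interpret E: elimination_step G X z m
      using z X(1) basis_closed by unfold_locales blast+
    have step: "g \<in> bracket_span ?Y m"
    proof (cases "weight z = m")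
      case True
      let ?w = "leaves z" and ?z = "group_bracket z"
      obtain h and i :: int where h: "h \<in> bracket_span ?Y m" and g: "g = h \<otimes> ?z [^] i"
        using E.bracket_span_eliminate[OF less.prems(5) True] .
      have "bracket_span ?Y m \<subseteq> {g \<in> dimension_subgroup (length ?w). coeff (magnus g) ?w = 0}"
        unfolding bracket_span_def
      proof (intro generate_subgroup_incl subgroup_coeff_magnus_zero)
        show "span_gens ?Y m \<subseteq> {g \<in> dimension_subgroup (length ?w). coeff (magnus g) ?w = 0}"
        proof
          fix x assume "x \<in> span_gens ?Y m"
          then consider "x \<in> lower_central G m"
            | c where "c \<in> brackets_over ?Y" "weight c = m" "x = group_bracket c"
            by (auto simp: span_gens_def)
          then show "x \<in> {g \<in> dimension_subgroup (length ?w). coeff (magnus g) ?w = 0}"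
          proof cases
            case 1
            then have x: "x \<in> dimension_subgroup (Suc m)"
              using lower_central_subset_dimension_subgroup by blast
            then have "coeff (magnus x - 1) ?w = 0"
              using True by (auto simp: dimension_subgroup_def order_ideal_def)
            then show ?thesis
              using x True dimension_subgroup_antimono[of m "Suc m"] by (auto simp: coeff_one)
          next
            case 2
            have cS: "set (leaves c) \<subseteq> S" using leaves_brackets_over[OF 2(1)] Y(4) by blast
            have "lie_series c \<in> above_slope (slope ?w)"
              using brackets_over_above_slope[OF 2(1)] lie_series_above_slope Y(1,2) by blast
            then have "coeff (lie_series c) ?w = 0"
              by (auto simp: above_slope_def slope_mult)
            then show ?thesis
              using magnus_group_bracket[OF cS] coeff_magnus_group_bracket[OF cS] 2 True by simp
          qed
        qed
      qed simp
      then have h0: "h \<in> dimension_subgroup (length ?w)" "coeff (magnus h) ?w = 0" using h by auto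
      have z1: "?z \<in> dimension_subgroup (length ?w)" "coeff (magnus ?z) ?w = 1"
        using magnus_group_bracket[OF X(1)[OF z]] coeff_magnus_group_bracket[OF X(1)[OF z]]
          coeff_leading_word[OF X(3)[OF z]] by simp_all
      have "coeff (magnus g - 1) ?w = 0"
        using less.prems(6) True by (auto simp: dimension_subgroup_def order_ideal_def)
      then have "coeff (magnus g) ?w = 0" by (simp add: coeff_one)
      \<comment> \<open>The word of leaves of the pivot shows the exponent of the pivot.\<close>
      moreover have "coeff (magnus g) ?w = i"
        using coeff_magnus_pow[OF z1(1), of i] coeff_magnus_mult[OF h0(1)] h0(2) z1(2) by (simp add: g)
      ultimately have "g = h"
        using subsetD[OF E.elim.bracket_span_closed h] by (simp add: g)
      then show ?thesis using h by simp
    qed (rule E.bracket_span_eliminate_other[OF less.prems(5)])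
    have fin: "finite (?W X)"
      by (rule finite_subset[OF _ finite_lists_length_le[OF finite_basis, of m]]) auto
    \<comment> \<open>The least slope has increased.\<close>
    have "leaves z \<in> ?W X - ?W ?Y" using z X Y(2) by force
    moreover have "?W ?Y \<subseteq> ?W X"
    proof
      fix w assume w: "w \<in> ?W ?Y"
      then obtain x where "x \<in> ?Y" "slope (leaves x) \<le> slope w" by blast
      then have "slope (leaves z) \<le> slope w" using Y(2) by fastforce
      then show "w \<in> ?W X" using w z by blast
    qed
    ultimately have "?W ?Y \<subset> ?W X" by blast
    then have "card (?W ?Y) < card (?W X)" using fin by (rule psubset_card_mono[rotated])
    then show ?thesis
      using Y less.prems step
      by (intro less.hyps[of ?Y] finite_eliminate is_code_eliminate z) auto
  qed
qed

text \<open>The theorem of Magnus and Witt, in the form of a step from one term of the lower central series to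
  the next. It implies that the quotients \<open>\<L>\<^sub>m\<close> are torsion-free.\<close>

theorem magnus_dimension_subgroup:
  assumes "g \<in> lower_central G k" "g \<in> dimension_subgroup (Suc (Suc k))"
  shows "g \<in> lower_central G (Suc k)"
proof -
  obtain digit where digit: "bij_betw digit S {0..<card S}"
    using ex_bij_betw_finite_nat[OF finite_basis] by blast
  \<comment> \<open>The base exceeds the number of digits by \<open>2\<close>, to be at least \<open>2\<close> for any basis.\<close>
  have D: "digit_alphabet S digit (Suc (Suc (card S)))"
  proof
    show "inj_on digit S" using digit by (rule bij_betw_imp_inj_on)
    show "digit s < Suc (Suc (card S))" if "s \<in> S" for s
      using bij_betw_apply[OF digit that] by simp
  qed simp
  interpret digit_alphabet S digit "Suc (Suc (card S))" by (rule D)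
  have "g \<in> bracket_span (Leaf ` S) (Suc k)"
    using lower_central_subset_span_of_basis[of "Suc k"] assms by auto
  then show ?thesis
    using assms finite_basis
    by (intro bracket_span_inter_dimension_subgroup[OF D _ is_code_Leaf, where m = "Suc k" and g = g]) (auto simp: has_leading_word_Leaf)
qed

end

section \<open>Actions on lattices and principal crossed homomorphisms\<close>

lemma mult_AutoGroup: "\<alpha> \<in> auto A \<Longrightarrow> \<beta> \<in> auto A \<Longrightarrow> \<alpha> \<otimes>\<^bsub>AutoGroup A\<^esub> \<beta> = compose (carrier A) \<alpha> \<beta>"
  and carrier_AutoGroup: "carrier (AutoGroup A) = auto A"
  and one_AutoGroup: "\<one>\<^bsub>AutoGroup A\<^esub> = (\<lambda>x\<in>carrier A. x)"
  by (simp_all add: AutoGroup_def BijGroup_def auto_def)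

lemma (in group) auto_inv:
  assumes "\<alpha> \<in> auto G"
  shows "inv\<^bsub>AutoGroup G\<^esub> \<alpha> \<in> auto G"
    and "u \<in> carrier G \<Longrightarrow> \<alpha> ((inv\<^bsub>AutoGroup G\<^esub> \<alpha>) u) = u"
    and "u \<in> carrier G \<Longrightarrow> (inv\<^bsub>AutoGroup G\<^esub> \<alpha>) (\<alpha> u) = u"
proof -
  interpret A: group "AutoGroup G" by (rule AutoGroup)
  have a: "\<alpha> \<in> carrier (AutoGroup G)" using assms by (simp add: carrier_AutoGroup)
  show i: "inv\<^bsub>AutoGroup G\<^esub> \<alpha> \<in> auto G" using A.inv_closed[OF a] by (simp add: carrier_AutoGroup)
  show "\<alpha> ((inv\<^bsub>AutoGroup G\<^esub> \<alpha>) u) = u" if "u \<in> carrier G"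
    using fun_cong[OF A.r_inv[OF a], of u] that
    by (simp add: mult_AutoGroup assms i one_AutoGroup compose_def)
  show "(inv\<^bsub>AutoGroup G\<^esub> \<alpha>) (\<alpha> u) = u" if "u \<in> carrier G"
    using fun_cong[OF A.l_inv[OF a], of u] that
    by (simp add: mult_AutoGroup assms i one_AutoGroup compose_def)
qed

lemma auto_closed: "\<alpha> \<in> auto G \<Longrightarrow> u \<in> carrier G \<Longrightarrow> \<alpha> u \<in> carrier G"
  and auto_mult: "\<alpha> \<in> auto G \<Longrightarrow> u \<in> carrier G \<Longrightarrow> v \<in> carrier G \<Longrightarrow> \<alpha> (u \<otimes>\<^bsub>G\<^esub> v) = \<alpha> u \<otimes>\<^bsub>G\<^esub> \<alpha> v"
  by (auto simp: auto_def hom_def)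

text \<open>The inverse of the action of \<open>g\<close> is the action of the inverse of \<open>g\<close>, so bijectivity comes
  from the laws of an action.\<close>

lemma module_actionI:
  assumes "group K" "comm_group A"
    and hom: "\<And>g. g \<in> carrier K \<Longrightarrow> act g \<in> hom A A"
    and mult: "\<And>g h x. g \<in> carrier K \<Longrightarrow> h \<in> carrier K \<Longrightarrow> x \<in> carrier A \<Longrightarrow>
      act (g \<otimes>\<^bsub>K\<^esub> h) x = act g (act h x)"
    and one: "\<And>x. x \<in> carrier A \<Longrightarrow> act \<one>\<^bsub>K\<^esub> x = x"
  shows "module_action K A (\<lambda>g. \<lambda>x\<in>carrier A. act g x)"
proof -
  interpret K: group K by fact
  interpret A: comm_group A by fact
  have closed: "act g x \<in> carrier A" if "g \<in> carrier K" "x \<in> carrier A" for g x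
    using hom_in_carrier[OF hom] that by blast
  have aut: "(\<lambda>x\<in>carrier A. act g x) \<in> auto A" if g: "g \<in> carrier K" for g
  proof -
    have "bij_betw (act g) (carrier A) (carrier A)"
    proof (rule bij_betw_byWitness[where f' = "act (inv\<^bsub>K\<^esub> g)"])
      show "\<forall>a\<in>carrier A. act (inv\<^bsub>K\<^esub> g) (act g a) = a" "\<forall>a\<in>carrier A. act g (act (inv\<^bsub>K\<^esub> g) a) = a"
        using g by (simp_all add: one flip: mult)
    qed (use closed g in auto)
    moreover have "(\<lambda>x\<in>carrier A. act g x) \<in> hom A A"
      using hom[OF g] by (auto simp: hom_def Pi_iff)
    ultimately show ?thesis by (simp add: auto_def Bij_def bij_betw_restrict_eq)
  qed
  show ?thesis unfolding module_action_def
  proof (rule homI)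
    fix g h assume gh: "g \<in> carrier K" "h \<in> carrier K"
    show "(\<lambda>x\<in>carrier A. act (g \<otimes>\<^bsub>K\<^esub> h) x)
      = (\<lambda>x\<in>carrier A. act g x) \<otimes>\<^bsub>AutoGroup A\<^esub> (\<lambda>x\<in>carrier A. act h x)"
      unfolding mult_AutoGroup[OF aut aut, OF gh]
      using gh by (intro ext) (auto simp: compose_def mult closed)
  qed (simp add: carrier_AutoGroup aut)
qed

lemma principal_crossed_hom:
  assumes K: "group K" and A: "comm_group A" and \<phi>: "module_action K A \<phi>" and a: "a \<in> carrier A"
  shows "crossed_hom K A \<phi> (\<lambda>g. \<phi> g a \<otimes>\<^bsub>A\<^esub> inv\<^bsub>A\<^esub> a)"
proof -
  interpret K: group K by fact
  interpret A: comm_group A by fact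
  have aut: "\<phi> g \<in> auto A" if "g \<in> carrier K" for g
    using hom_in_carrier[OF \<phi>[unfolded module_action_def]] that by (simp add: carrier_AutoGroup)
  show ?thesis unfolding crossed_hom_def
  proof (intro conjI ballI Pi_I)
    fix g assume g: "g \<in> carrier K"
    then show "\<phi> g a \<otimes>\<^bsub>A\<^esub> inv\<^bsub>A\<^esub> a \<in> carrier A" using a auto_closed[OF aut] by auto
    fix h assume h: "h \<in> carrier K"
    interpret h: group_hom A A "\<phi> g" by (rule A.auto_group_hom[OF aut[OF g]])
    have c: "\<phi> g a \<in> carrier A" "\<phi> h a \<in> carrier A" "\<phi> g (\<phi> h a) \<in> carrier A"
      using a g h auto_closed[OF aut] by auto
    have "\<phi> (g \<otimes>\<^bsub>K\<^esub> h) a = \<phi> g (\<phi> h a)"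
      using hom_mult[OF \<phi>[unfolded module_action_def] g h] a
      by (simp add: mult_AutoGroup aut g h compose_def)
    moreover have "\<phi> g (\<phi> h a \<otimes>\<^bsub>A\<^esub> inv\<^bsub>A\<^esub> a) = \<phi> g (\<phi> h a) \<otimes>\<^bsub>A\<^esub> inv\<^bsub>A\<^esub> \<phi> g a"
      using a c by simp
    moreover have "inv\<^bsub>A\<^esub> \<phi> g a \<otimes>\<^bsub>A\<^esub> (\<phi> g a \<otimes>\<^bsub>A\<^esub> inv\<^bsub>A\<^esub> a) = inv\<^bsub>A\<^esub> a"
      using a c by (simp add: A.inv_mult_cancel)
    ultimately show "\<phi> (g \<otimes>\<^bsub>K\<^esub> h) a \<otimes>\<^bsub>A\<^esub> inv\<^bsub>A\<^esub> a
      = \<phi> g (\<phi> h a \<otimes>\<^bsub>A\<^esub> inv\<^bsub>A\<^esub> a) \<otimes>\<^bsub>A\<^esub> (\<phi> g a \<otimes>\<^bsub>A\<^esub> inv\<^bsub>A\<^esub> a)"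
      using a c by (simp add: A.m_assoc)
  qed
qed

text \<open>Any lattice with an action may be replaced by a lattice of finitely supported integer functions on
  \<open>nat\<close>.\<close>

lemma lattice_transport:
  assumes K: "group K" and B: "finite_rank_free_abelian B"
    and hom: "\<And>g. g \<in> carrier K \<Longrightarrow> act g \<in> hom B B"
    and mult: "\<And>g h x. g \<in> carrier K \<Longrightarrow> h \<in> carrier K \<Longrightarrow> x \<in> carrier B \<Longrightarrow>
      act (g \<otimes>\<^bsub>K\<^esub> h) x = act g (act h x)"
    and one: "\<And>x. x \<in> carrier B \<Longrightarrow> act \<one>\<^bsub>K\<^esub> x = x"
  obtains A :: "(nat \<Rightarrow>\<^sub>0 int) monoid" and \<phi> h where
    "finite_rank_free_abelian A" "module_action K A \<phi>" "h \<in> iso B A"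
    "\<And>g x. g \<in> carrier K \<Longrightarrow> x \<in> carrier B \<Longrightarrow> \<phi> g (h x) = h (act g x)"
proof -
  obtain n :: nat and h where h: "h \<in> iso B (free_Abelian_group {..<n})"
    using B by (auto simp: finite_rank_free_abelian_def is_iso_def)
  let ?A = "free_Abelian_group {..<n}"
  interpret B: comm_group B using B by (simp add: finite_rank_free_abelian_def)
  interpret A: comm_group ?A by (rule abelian_free_Abelian_group)
  define h' where "h' = inv_into (carrier B) h"
  have h': "h' \<in> iso ?A B" unfolding h'_def by (rule B.iso_set_sym[OF h])
  have hh: "h \<in> hom B ?A" and hh': "h' \<in> hom ?A B" using h h' by (auto simp: iso_def)
  have cancel: "h' (h x) = x" if "x \<in> carrier B" for x
    using h that by (auto simp: h'_def iso_def bij_betw_def)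
  have cancel': "h (h' y) = y" if "y \<in> carrier ?A" for y
    using h that by (auto simp: h'_def iso_def bij_betw_def f_inv_into_f)
  have 1: "finite_rank_free_abelian ?A"
    using A.comm_group_axioms iso_refl unfolding finite_rank_free_abelian_def by blast
  have 2: "module_action K ?A (\<lambda>g. \<lambda>x\<in>carrier ?A. h (act g (h' x)))"
  proof (rule module_actionI[OF K A.comm_group_axioms])
    show "(\<lambda>x. h (act g (h' x))) \<in> hom ?A ?A" if "g \<in> carrier K" for g
      using hom_compose[OF hom_compose[OF hh' hom[OF that]] hh] by (simp add: o_def)
    show "h (act (g \<otimes>\<^bsub>K\<^esub> g') (h' x)) = h (act g (h' (h (act g' (h' x)))))"
      if "g \<in> carrier K" "g' \<in> carrier K" "x \<in> carrier ?A" for g g' x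
      using mult[OF that(1,2) hom_in_carrier[OF hh' that(3)]]
        cancel[OF hom_in_carrier[OF hom[OF that(2)] hom_in_carrier[OF hh' that(3)]]] by simp
    show "h (act \<one>\<^bsub>K\<^esub> (h' x)) = x" if "x \<in> carrier ?A" for x
      using one[OF hom_in_carrier[OF hh' that]] cancel'[OF that] by simp
  qed
  show ?thesis
  proof (rule that[OF 1 2 h])
    fix g x assume "g \<in> carrier K" "x \<in> carrier B"
    then show "(\<lambda>x\<in>carrier ?A. h (act g (h' x))) (h x) = h (act g x)"
      using hom_in_carrier[OF hh] cancel by (simp del: carrier_free_Abelian_group_iff)
  qed
qed

section \<open>The action of automorphisms on truncated series\<close>

definition monomial_product :: "('a \<Rightarrow> 'b) \<Rightarrow> 'a list \<Rightarrow> 'b::monoid_mult" where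
  "monomial_product \<xi> w = prod_list (map \<xi> w)"

lemma monomial_product_simps [simp]:
  "monomial_product \<xi> [] = 1" "monomial_product \<xi> (s # w) = \<xi> s * monomial_product \<xi> w"
  by (simp_all add: monomial_product_def)

lemma coeff_monomial: "coeff (monomial_product series_var w) v = (if v = w then 1 else 0)"
proof (induction w arbitrary: v)
  case Nil then show ?case by (simp add: coeff_one)
next
  case (Cons s w)
  then show ?case
    by (cases v) (auto simp: coeff_var_mult_Nil coeff_var_mult_Cons)
qed

lemma monomial_product_order:
  "(\<And>s. s \<in> set w \<Longrightarrow> \<xi> s \<in> order_ideal (Suc 0)) \<Longrightarrow> monomial_product \<xi> w \<in> order_ideal (length w)"
proof (induction w)
  case (Cons s w)
  then show ?case using order_ideal_mult[of "\<xi> s" "Suc 0" "monomial_product \<xi> w" "length w"] by simp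
qed (simp add: order_ideal_def)

lemma of_int_mult_left_commute: "of_int c * (a * b) = a * (of_int c * b)" for a b :: "'b :: ring_1"
  by (simp only: mult.assoc[symmetric] mult_of_int_commute[of c a])

context free_group_on_basis
begin

definition words :: "nat \<Rightarrow> 'a list set" where
  "words k = {w. set w \<subseteq> S \<and> length w \<le> k}"

lemma finite_words: "finite (words k)"
  unfolding words_def by (rule finite_lists_length_le[OF finite_basis])

definition truncated_series :: "nat \<Rightarrow> 'a series set" where
  "truncated_series k = {f. \<forall>w. coeff f w \<noteq> 0 \<longrightarrow> w \<in> words k}"

lemma truncated_series_zero: "0 \<in> truncated_series k"
  and truncated_series_add: "f \<in> truncated_series k \<Longrightarrow> g \<in> truncated_series k \<Longrightarrow> f + g \<in> truncated_series k"
  and truncated_series_diff: "f \<in> truncated_series k \<Longrightarrow> g \<in> truncated_series k \<Longrightarrow> f - g \<in> truncated_series k"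
  by (auto simp: truncated_series_def) (metis add.right_neutral diff_zero)+

lemma trunc_magnus_mem: "g \<in> carrier G \<Longrightarrow> trunc k (magnus g) \<in> truncated_series k"
  using coeff_magnus_support by (auto simp: truncated_series_def coeff_trunc words_def split: if_splits)

lemma trunc_truncated: "f \<in> truncated_series k \<Longrightarrow> trunc k f = f"
  by (rule series_eqI) (auto simp: truncated_series_def coeff_trunc words_def)

inductive_set magnus_span :: "'a series set" where
  zero: "0 \<in> magnus_span"
| magnus: "g \<in> carrier G \<Longrightarrow> magnus g \<in> magnus_span"
| diff: "f \<in> magnus_span \<Longrightarrow> h \<in> magnus_span \<Longrightarrow> f - h \<in> magnus_span"

lemma magnus_span_add: "f \<in> magnus_span \<Longrightarrow> h \<in> magnus_span \<Longrightarrow> f + h \<in> magnus_span"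
  using magnus_span.diff[of f "0 - h"] magnus_span.diff[OF magnus_span.zero, of h] by simp

lemma magnus_span_var_mult: "f \<in> magnus_span \<Longrightarrow> s \<in> S \<Longrightarrow> series_var s * f \<in> magnus_span"
proof (induction rule: magnus_span.induct)
  case (magnus g)
  then have "series_var s * magnus g = magnus (s \<otimes> g) - magnus g"
    by (simp add: magnus_mult magnus_basis basis_closed algebra_simps)
  then show ?case using magnus by (auto intro!: magnus_span.intros simp: basis_closed)
qed (auto simp: right_diff_distrib intro: magnus_span.intros)

lemma magnus_span_monomial: "set w \<subseteq> S \<Longrightarrow> monomial_product series_var w \<in> magnus_span"
proof (induction w)
  case Nil
  then show ?case using magnus_span.magnus[OF one_closed] by (simp add: magnus_one)
qed (simp add: magnus_span_var_mult)

lemma magnus_span_of_int_mult: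
  assumes "f \<in> magnus_span"
  shows "of_int c * f \<in> magnus_span"
proof -
  have nat: "of_nat n * f \<in> magnus_span" for n
    by (induction n) (auto simp: distrib_right intro: magnus_span_add magnus_span.zero assms)
  show ?thesis
  proof (cases c)
    case (neg n)
    then show ?thesis using magnus_span.diff[OF magnus_span.zero nat[of "Suc n"]] by (simp del: of_nat_Suc)
  qed (simp add: nat)
qed

text \<open>A monomial is a product of factors \<open>magnus s - 1\<close>, so expanding it yields an integer
  combination of expansions of group elements.\<close>

lemma truncated_subset_magnus_span:
  assumes "f \<in> truncated_series k"
  shows "f \<in> magnus_span"
proof -
  have "f = (\<Sum>w\<in>words k. of_int (coeff f w) * monomial_product series_var w)"
  proof (rule series_eqI)
    fix v
    have "coeff (\<Sum>w\<in>words k. of_int (coeff f w) * monomial_product series_var w) v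
      = (\<Sum>w\<in>words k. if w = v then coeff f v else 0)"
      by (auto simp: coeff_monomial intro!: sum.cong)
    also have "\<dots> = coeff f v" using assms by (auto simp: finite_words truncated_series_def)
    finally show "coeff f v = coeff (\<Sum>w\<in>words k. of_int (coeff f w) * monomial_product series_var w) v" ..
  qed
  also have "\<dots> \<in> magnus_span"
  proof -
    have "(\<Sum>w\<in>W. of_int (coeff f w) * monomial_product series_var w) \<in> magnus_span"
      if "finite W" "W \<subseteq> words k" for W
      using that
    proof (induction W rule: finite_induct)
      case (insert w W)
      then have "monomial_product series_var w \<in> magnus_span"
        by (intro magnus_span_monomial) (auto simp: words_def)
      then show ?case using insert by (auto intro!: magnus_span_add magnus_span_of_int_mult)
    qed (simp add: magnus_span.zero)
    then show ?thesis using finite_words by blast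
  qed
  finally show ?thesis .
qed

text \<open>The truncated expansions of group elements span \<open>truncated_series k\<close>. Additive
  maps on this group are hence compared on group elements, which makes the laws of the action
  below evident.\<close>

lemma truncated_series_induct [consumes 1, case_names zero magnus diff]:
  assumes f: "f \<in> truncated_series k" and "P 0" and "\<And>g. g \<in> carrier G \<Longrightarrow> P (trunc k (magnus g))"
    and "\<And>f h. f \<in> truncated_series k \<Longrightarrow> h \<in> truncated_series k \<Longrightarrow> P f \<Longrightarrow> P h \<Longrightarrow> P (f - h)"
  shows "P f"
proof -
  have "trunc k f \<in> truncated_series k \<and> P (trunc k f)" if "f \<in> magnus_span" for f
    using that
    by (induction rule: magnus_span.induct)
       (auto simp: trunc_zero trunc_diff truncated_series_zero truncated_series_diff trunc_magnus_mem assms)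
  from this[OF truncated_subset_magnus_span[OF f]] show ?thesis by (simp add: trunc_truncated[OF f])
qed

text \<open>Substitution of \<open>magnus (\<alpha> s) - 1\<close> for the variable of \<open>s\<close>. Longer words than \<open>k\<close> may be
  omitted, because the substituted series have no constant term.\<close>

definition substitute :: "nat \<Rightarrow> ('a \<Rightarrow> 'a) \<Rightarrow> 'a series \<Rightarrow> 'a series" where
  "substitute k \<alpha> f = (\<Sum>w\<in>words k. of_int (coeff f w) * monomial_product (\<lambda>s. magnus (\<alpha> s) - 1) w)"

definition series_act :: "nat \<Rightarrow> ('a \<Rightarrow> 'a) \<Rightarrow> 'a series \<Rightarrow> 'a series" where
  "series_act k \<alpha> f = trunc k (substitute k \<alpha> f)"

lemma substitute_add: "substitute k \<alpha> (f + g) = substitute k \<alpha> f + substitute k \<alpha> g"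
  and substitute_diff: "substitute k \<alpha> (f - g) = substitute k \<alpha> f - substitute k \<alpha> g"
  by (simp_all add: substitute_def distrib_right left_diff_distrib sum.distrib sum_subtractf)

lemma series_act_add: "series_act k \<alpha> (f + g) = series_act k \<alpha> f + series_act k \<alpha> g"
  and series_act_diff: "series_act k \<alpha> (f - g) = series_act k \<alpha> f - series_act k \<alpha> g"
  and series_act_zero: "series_act k \<alpha> 0 = 0"
  by (simp_all only: series_act_def substitute_add substitute_diff trunc_add trunc_diff)
     (simp add: substitute_def trunc_zero)

lemma series_act_trunc: "series_act k \<alpha> (trunc k f) = series_act k \<alpha> f"
  unfolding series_act_def substitute_def
  by (intro arg_cong[where f = "trunc k"] sum.cong) (auto simp: coeff_trunc words_def)

text \<open>The two sides differ by the contribution of the words of length \<open>k\<close>, which become longer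
  than \<open>k\<close> on multiplication by a variable.\<close>

lemma substitute_var_mult:
  assumes s: "s \<in> S" and \<alpha>: "\<And>s. s \<in> S \<Longrightarrow> \<alpha> s \<in> carrier G"
  shows "substitute k \<alpha> (series_var s * f) - (magnus (\<alpha> s) - 1) * substitute k \<alpha> f \<in> order_ideal (Suc k)"
proof -
  let ?\<xi> = "\<lambda>s. magnus (\<alpha> s) - 1"
  let ?P = "monomial_product ?\<xi>"
  let ?V = "{w \<in> words k. length w < k}" and ?T = "{w \<in> words k. length w = k}"
  have "substitute k \<alpha> (series_var s * f) = (\<Sum>w\<in>(#) s ` ?V. of_int (coeff (series_var s * f) w) * ?P w)"
    unfolding substitute_def
  proof (rule sum.mono_neutral_right[OF finite_words])
    show "(#) s ` ?V \<subseteq> words k" using s by (auto simp: words_def)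
    show "\<forall>w\<in>words k - (#) s ` ?V. of_int (coeff (series_var s * f) w) * ?P w = 0"
    proof
      fix w assume "w \<in> words k - (#) s ` ?V"
      then show "of_int (coeff (series_var s * f) w) * ?P w = 0"
        by (cases w) (auto simp: coeff_var_mult_Nil coeff_var_mult_Cons words_def)
    qed
  qed
  also have "\<dots> = (\<Sum>w\<in>?V. of_int (coeff f w) * (?\<xi> s * ?P w))"
    by (subst sum.reindex) (auto simp: coeff_var_mult_Cons)
  also have "\<dots> = (\<Sum>w\<in>?V. ?\<xi> s * (of_int (coeff f w) * ?P w))"
    by (rule sum.cong[OF refl]) (rule of_int_mult_left_commute)
  finally have 1: "substitute k \<alpha> (series_var s * f) = (\<Sum>w\<in>?V. ?\<xi> s * (of_int (coeff f w) * ?P w))" .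
  have "words k = ?V \<union> ?T" by (auto simp: words_def)
  then have "substitute k \<alpha> f = (\<Sum>w\<in>?V. of_int (coeff f w) * ?P w) + (\<Sum>w\<in>?T. of_int (coeff f w) * ?P w)"
    unfolding substitute_def using finite_words[of k] by (subst sum.union_disjoint[symmetric]) auto
  then have "substitute k \<alpha> (series_var s * f) - ?\<xi> s * substitute k \<alpha> f
      = 0 - (\<Sum>w\<in>?T. ?\<xi> s * (of_int (coeff f w) * ?P w))"
    by (simp add: 1 distrib_left sum_distrib_left)
  also have "\<dots> \<in> order_ideal (Suc k)"
  proof (rule order_ideal_diff[OF order_ideal_zero])
    have "?\<xi> s * (of_int (coeff f w) * ?P w) \<in> order_ideal (Suc k)" if w: "w \<in> ?T" for w
    proof -
      have "?P w \<in> order_ideal k"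
        using monomial_product_order[of w ?\<xi>] w \<alpha> magnus_minus_one by (auto simp: words_def)
      then have "of_int (coeff f w) * ?P w \<in> order_ideal k" by (rule order_ideal_mult_left)
      then show ?thesis using order_ideal_mult[OF magnus_minus_one[OF \<alpha>[OF s]]] by fastforce
    qed
    then show "(\<Sum>w\<in>?T. ?\<xi> s * (of_int (coeff f w) * ?P w)) \<in> order_ideal (Suc k)"
      by (simp add: order_ideal_def)
  qed
  finally show ?thesis .
qed

lemma substitute_basis_mult:
  assumes s: "s \<in> S" and \<alpha>: "\<And>s. s \<in> S \<Longrightarrow> \<alpha> s \<in> carrier G"
  shows "substitute k \<alpha> (magnus s * f) - magnus (\<alpha> s) * substitute k \<alpha> f \<in> order_ideal (Suc k)"
  using substitute_var_mult[OF assms, where k = k and f = f]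
  by (simp add: magnus_basis[OF s] substitute_add algebra_simps)

text \<open>Up to terms of degree greater than \<open>k\<close>, both sides are multiplied by \<open>magnus (\<alpha> s)\<close> when
  \<open>g\<close> is multiplied by \<open>s\<close>. As this series is invertible, the same holds for the inverse of \<open>s\<close>.\<close>

lemma series_act_magnus:
  assumes \<alpha>: "\<alpha> \<in> hom G G" and g: "g \<in> carrier G"
  shows "series_act k \<alpha> (magnus g) = trunc k (magnus (\<alpha> g))"
proof -
  interpret \<alpha>: group_hom G G \<alpha> using \<alpha> by unfold_locales
  have c: "\<alpha> s \<in> carrier G" if "s \<in> S" for s using that basis_closed by simp
  have "substitute k \<alpha> (magnus g) - magnus (\<alpha> g) \<in> order_ideal (Suc k)"
    using g
  proof (induction rule: free_induct)
    case one
    have "substitute k \<alpha> 1 = (\<Sum>w\<in>words k. if w = [] then 1 else 0)"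
      unfolding substitute_def by (rule sum.cong) (auto simp: coeff_one)
    also have "\<dots> = 1" using finite_words by (simp add: words_def)
    finally show ?case by (simp add: magnus_one order_ideal_zero)
  next
    case (letter s g)
    have "substitute k \<alpha> (magnus (s \<otimes> g)) - magnus (\<alpha> (s \<otimes> g))
      = (substitute k \<alpha> (magnus s * magnus g) - magnus (\<alpha> s) * substitute k \<alpha> (magnus g))
        + magnus (\<alpha> s) * (substitute k \<alpha> (magnus g) - magnus (\<alpha> g))"
      using letter by (simp add: magnus_mult basis_closed algebra_simps)
    also have "\<dots> \<in> order_ideal (Suc k)"
      using letter by (intro order_ideal_add order_ideal_mult_left substitute_basis_mult c) auto
    finally show ?case .
  next
    case (inv_letter s g)
    let ?h = "inv s \<otimes> g"
    have s: "s \<in> carrier G" "\<alpha> s \<in> carrier G" using inv_letter basis_closed by auto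
    have h: "magnus s * magnus ?h = magnus g"
      using inv_letter s by (simp add: inv_mult_cancel flip: magnus_mult)
    have ah: "magnus (\<alpha> ?h) = magnus (inv (\<alpha> s)) * magnus (\<alpha> g)"
      using inv_letter s by (simp add: magnus_mult)
    have "substitute k \<alpha> (magnus ?h) - magnus (\<alpha> ?h)
      = magnus (inv (\<alpha> s)) * ((substitute k \<alpha> (magnus g) - magnus (\<alpha> g))
        - (substitute k \<alpha> (magnus s * magnus ?h) - magnus (\<alpha> s) * substitute k \<alpha> (magnus ?h)))"
      unfolding h ah using magnus_inv(2)[OF s(2)] by (simp add: algebra_simps flip: mult.assoc)
    also have "\<dots> \<in> order_ideal (Suc k)"
      by (rule order_ideal_mult_left[OF order_ideal_diff[OF inv_letter(3) substitute_basis_mult[OF inv_letter(1) c]]])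
    finally show ?case .
  qed
  then show ?thesis by (simp add: series_act_def trunc_eq_iff)
qed

lemma series_act_one: "\<alpha> \<in> hom G G \<Longrightarrow> series_act k \<alpha> 1 = trunc k 1"
  using series_act_magnus[of \<alpha> "\<one>"] hom_one[OF _ is_group is_group, of \<alpha>] by (simp add: magnus_one)

lemma series_act_closed:
  assumes "\<alpha> \<in> hom G G" "f \<in> truncated_series k"
  shows "series_act k \<alpha> f \<in> truncated_series k"
  using assms(2)
  by (induction rule: truncated_series_induct)
     (use hom_in_carrier[OF assms(1)] in \<open>auto simp: series_act_zero series_act_diff series_act_trunc
        series_act_magnus[OF assms(1)] truncated_series_zero trunc_magnus_mem truncated_series_diff\<close>)

lemma series_act_compose:
  assumes \<alpha>: "\<alpha> \<in> hom G G" and \<beta>: "\<beta> \<in> hom G G" and \<gamma>: "\<gamma> \<in> hom G G"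
    and "\<And>u. u \<in> carrier G \<Longrightarrow> \<gamma> u = \<alpha> (\<beta> u)" and "f \<in> truncated_series k"
  shows "series_act k \<gamma> f = series_act k \<alpha> (series_act k \<beta> f)"
  using assms(5)
  by (induction rule: truncated_series_induct)
     (use hom_in_carrier[OF \<beta>] assms(4) in \<open>auto simp: series_act_zero series_act_diff series_act_trunc
        series_act_magnus[OF \<alpha>] series_act_magnus[OF \<beta>] series_act_magnus[OF \<gamma>]\<close>)

lemma series_act_id:
  assumes \<alpha>: "\<alpha> \<in> hom G G" and "\<And>u. u \<in> carrier G \<Longrightarrow> \<alpha> u = u" and "f \<in> truncated_series k"
  shows "series_act k \<alpha> f = f"
  using assms(3)
  by (induction rule: truncated_series_induct)
     (use assms(2) in \<open>auto simp: series_act_zero series_act_diff series_act_trunc series_act_magnus[OF \<alpha>]\<close>)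

end

section \<open>The module of homomorphisms into truncated series\<close>

context free_group_on_basis
begin

definition hom_module :: "nat \<Rightarrow> ('a \<Rightarrow> 'a series) monoid" where
  "hom_module k =
    \<lparr>carrier = {f \<in> carrier G \<rightarrow>\<^sub>E truncated_series k.
       \<forall>u\<in>carrier G. \<forall>v\<in>carrier G. f (u \<otimes> v) = f u + f v},
     mult = \<lambda>f g. \<lambda>u\<in>carrier G. f u + g u,
     one = \<lambda>u\<in>carrier G. 0\<rparr>"

lemma hom_module_memI:
  assumes "\<And>u. u \<in> carrier G \<Longrightarrow> f u \<in> truncated_series k"
    and "\<And>u v. u \<in> carrier G \<Longrightarrow> v \<in> carrier G \<Longrightarrow> f (u \<otimes> v) = f u + f v"
  shows "(\<lambda>u\<in>carrier G. f u) \<in> carrier (hom_module k)"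
  using assms by (auto simp: hom_module_def)

lemma hom_module_memD:
  assumes "f \<in> carrier (hom_module k)"
  shows "u \<in> carrier G \<Longrightarrow> f u \<in> truncated_series k"
    and "u \<in> carrier G \<Longrightarrow> v \<in> carrier G \<Longrightarrow> f (u \<otimes> v) = f u + f v"
    and "f \<in> extensional (carrier G)"
  using assms by (auto simp: hom_module_def PiE_def)

lemma hom_module_mult: "u \<in> carrier G \<Longrightarrow> (f \<otimes>\<^bsub>hom_module k\<^esub> g) u = f u + g u"
  by (simp add: hom_module_def)

lemma hom_module_one: "f \<in> carrier (hom_module k) \<Longrightarrow> f \<one> = 0"
  using hom_module_memD(2)[of f k \<one> \<one>] by simp

lemma hom_module_inv:
  assumes "f \<in> carrier (hom_module k)" "u \<in> carrier G"
  shows "f (inv u) = - f u"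
  using hom_module_memD(2)[OF assms(1), of "inv u" u] hom_module_one[OF assms(1)] assms(2)
  by (simp add: eq_neg_iff_add_eq_0)

lemma comm_group_hom_module: "comm_group (hom_module k)"
proof (rule comm_groupI)
  fix f g assume fg: "f \<in> carrier (hom_module k)" "g \<in> carrier (hom_module k)"
  have "f \<otimes>\<^bsub>hom_module k\<^esub> g = (\<lambda>u\<in>carrier G. f u + g u)" by (simp add: hom_module_def)
  also have "\<dots> \<in> carrier (hom_module k)"
    using hom_module_memD[OF fg(1)] hom_module_memD[OF fg(2)]
    by (intro hom_module_memI) (simp_all add: truncated_series_add)
  finally show "f \<otimes>\<^bsub>hom_module k\<^esub> g \<in> carrier (hom_module k)" .
  show "f \<otimes>\<^bsub>hom_module k\<^esub> g = g \<otimes>\<^bsub>hom_module k\<^esub> f"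
    by (auto simp: hom_module_def add.commute)
  fix h assume "h \<in> carrier (hom_module k)"
  show "f \<otimes>\<^bsub>hom_module k\<^esub> g \<otimes>\<^bsub>hom_module k\<^esub> h = f \<otimes>\<^bsub>hom_module k\<^esub> (g \<otimes>\<^bsub>hom_module k\<^esub> h)"
    by (auto simp: hom_module_def add.assoc)
next
  show "\<one>\<^bsub>hom_module k\<^esub> \<in> carrier (hom_module k)"
    using hom_module_memI[of "\<lambda>u. 0" k] by (simp add: hom_module_def truncated_series_zero)
next
  fix f assume f: "f \<in> carrier (hom_module k)"
  show "\<one>\<^bsub>hom_module k\<^esub> \<otimes>\<^bsub>hom_module k\<^esub> f = f"
    using hom_module_memD(3)[OF f] by (auto simp: hom_module_def extensional_def)
  have "(\<lambda>u\<in>carrier G. 0 - f u) \<in> carrier (hom_module k)"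
    using hom_module_memD[OF f]
    by (intro hom_module_memI truncated_series_diff truncated_series_zero) simp_all
  moreover have "(\<lambda>u\<in>carrier G. 0 - f u) \<otimes>\<^bsub>hom_module k\<^esub> f = \<one>\<^bsub>hom_module k\<^esub>"
    by (auto simp: hom_module_def)
  ultimately show "\<exists>g\<in>carrier (hom_module k). g \<otimes>\<^bsub>hom_module k\<^esub> f = \<one>\<^bsub>hom_module k\<^esub>" by blast
qed

lemma hom_module_eqI:
  assumes f: "f \<in> carrier (hom_module k)" and g: "g \<in> carrier (hom_module k)"
    and eq: "\<And>s. s \<in> S \<Longrightarrow> f s = g s"
  shows "f = g"
proof (rule extensionalityI[OF hom_module_memD(3)[OF f] hom_module_memD(3)[OF g]])
  show "f u = g u" if "u \<in> carrier G" for u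
    using that
    by (induction rule: free_induct)
       (simp_all add: hom_module_one[OF f] hom_module_one[OF g] hom_module_memD(2)[OF f] hom_module_memD(2)[OF g]
          hom_module_inv[OF f] hom_module_inv[OF g] basis_closed eq)
qed

lemma exponent_add:
  assumes "u \<in> carrier G" "v \<in> carrier G"
  shows "coeff (magnus (u \<otimes> v)) [s] = coeff (magnus u) [s] + coeff (magnus v) [s]"
  using assms magnus_minus_one by (intro coeff_magnus_mult) (auto simp: dimension_subgroup_def)

lemma exponent_basis: "s \<in> S \<Longrightarrow> coeff (magnus s) [t] = (if t = s then 1 else 0)"
  by (simp add: magnus_basis coeff_one coeff_var)

text \<open>The coefficient of the one-letter word \<open>[s]\<close> in \<open>magnus u\<close> is the exponent sum of \<open>s\<close> in
  \<open>u\<close>. The homomorphism defined here has the prescribed values on the basis.\<close>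

definition hom_of_coeffs :: "nat \<Rightarrow> ('a \<times> 'a list \<Rightarrow>\<^sub>0 int) \<Rightarrow> 'a \<Rightarrow> 'a series" where
  "hom_of_coeffs k p = (\<lambda>u\<in>carrier G. \<Sum>s\<in>S. of_int (coeff (magnus u) [s]) *
     Series (\<lambda>w. if w \<in> words k then Poly_Mapping.lookup p (s, w) else 0))"

lemma coeff_hom_of_coeffs:
  "u \<in> carrier G \<Longrightarrow> coeff (hom_of_coeffs k p u) w =
    (\<Sum>s\<in>S. coeff (magnus u) [s] * (if w \<in> words k then Poly_Mapping.lookup p (s, w) else 0))"
  by (simp add: hom_of_coeffs_def)

lemma coeff_hom_of_coeffs_basis:
  assumes "s \<in> S"
  shows "coeff (hom_of_coeffs k p s) w = (if w \<in> words k then Poly_Mapping.lookup p (s, w) else 0)"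
proof -
  have "coeff (hom_of_coeffs k p s) w
    = (\<Sum>t\<in>S. if t = s then (if w \<in> words k then Poly_Mapping.lookup p (s, w) else 0) else 0)"
    unfolding coeff_hom_of_coeffs[OF basis_closed[OF assms]]
    by (rule sum.cong) (auto simp: exponent_basis assms)
  then show ?thesis using finite_basis assms by simp
qed

lemma hom_of_coeffs_closed: "hom_of_coeffs k p \<in> carrier (hom_module k)"
  unfolding hom_of_coeffs_def
proof (rule hom_module_memI)
  fix u assume u: "u \<in> carrier G"
  show "(\<Sum>s\<in>S. of_int (coeff (magnus u) [s]) * Series (\<lambda>w. if w \<in> words k then Poly_Mapping.lookup p (s, w) else 0))
    \<in> truncated_series k"
    by (auto simp: truncated_series_def intro: ccontr)
  fix v assume v: "v \<in> carrier G"
  show "(\<Sum>s\<in>S. of_int (coeff (magnus (u \<otimes> v)) [s]) * Series (\<lambda>w. if w \<in> words k then Poly_Mapping.lookup p (s, w) else 0))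
    = (\<Sum>s\<in>S. of_int (coeff (magnus u) [s]) * Series (\<lambda>w. if w \<in> words k then Poly_Mapping.lookup p (s, w) else 0))
    + (\<Sum>s\<in>S. of_int (coeff (magnus v) [s]) * Series (\<lambda>w. if w \<in> words k then Poly_Mapping.lookup p (s, w) else 0))"
    by (simp add: exponent_add[OF u v] distrib_right sum.distrib)
qed

lemma hom_of_coeffs_iso: "hom_of_coeffs k \<in> iso (free_Abelian_group (S \<times> words k)) (hom_module k)"
proof (rule isoI)
  let ?I = "S \<times> words k"
  interpret B: comm_group "hom_module k" by (rule comm_group_hom_module)
  note mem = hom_of_coeffs_closed
  have "hom_of_coeffs k (p + q) = hom_of_coeffs k p \<otimes>\<^bsub>hom_module k\<^esub> hom_of_coeffs k q" for p q
  proof (rule hom_module_eqI[OF mem])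
    show "hom_of_coeffs k p \<otimes>\<^bsub>hom_module k\<^esub> hom_of_coeffs k q \<in> carrier (hom_module k)"
      by (intro B.m_closed mem)
    show "hom_of_coeffs k (p + q) s = (hom_of_coeffs k p \<otimes>\<^bsub>hom_module k\<^esub> hom_of_coeffs k q) s" if "s \<in> S" for s
      by (rule series_eqI) (simp add: hom_module_mult basis_closed that coeff_hom_of_coeffs_basis Poly_Mapping.lookup_add)
  qed
  then show "hom_of_coeffs k \<in> hom (free_Abelian_group ?I) (hom_module k)"
    by (intro homI) (simp_all add: mem)
  show "bij_betw (hom_of_coeffs k) (carrier (free_Abelian_group ?I)) (carrier (hom_module k))"
    unfolding bij_betw_def
  proof (intro conjI inj_onI equalityI subsetI)
    fix p q assume p: "p \<in> carrier (free_Abelian_group ?I)" and q: "q \<in> carrier (free_Abelian_group ?I)"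
      and eq: "hom_of_coeffs k p = hom_of_coeffs k q"
    show "p = q"
    proof (rule Poly_Mapping.poly_mapping_eqI)
      fix i :: "'a \<times> 'a list"
      obtain s w where i: "i = (s, w)" by (cases i)
      show "Poly_Mapping.lookup p i = Poly_Mapping.lookup q i"
      proof (cases "i \<in> ?I")
        case True
        then show ?thesis
          using coeff_hom_of_coeffs_basis[of s k p w] coeff_hom_of_coeffs_basis[of s k q w]
          unfolding eq i by simp
      next
        case False
        then have "i \<notin> Poly_Mapping.keys p" "i \<notin> Poly_Mapping.keys q" using p q by auto
        then show ?thesis by (simp add: Poly_Mapping.in_keys_iff)
      qed
    qed
  next
    fix f assume f: "f \<in> carrier (hom_module k)"
    define c where "c = (\<lambda>i. if i \<in> ?I then coeff (f (fst i)) (snd i) else 0)"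
    have "{i. c i \<noteq> 0} \<subseteq> ?I" unfolding c_def by auto
    then have "finite {i. c i \<noteq> 0}" using finite_basis finite_words finite_subset by blast
    then have p: "Poly_Mapping.lookup (Poly_Mapping.Abs_poly_mapping c) = c"
      by (rule Poly_Mapping.lookup_Abs_poly_mapping)
    define p where "p = Poly_Mapping.Abs_poly_mapping c"
    have "Poly_Mapping.keys p \<subseteq> ?I"
      using \<open>{i. c i \<noteq> 0} \<subseteq> ?I\<close> by (simp add: Poly_Mapping.keys.rep_eq p_def p)
    moreover have "hom_of_coeffs k p = f"
    proof (rule hom_module_eqI[OF mem f])
      fix s assume s: "s \<in> S"
      then have fs: "coeff (f s) w = 0" if "w \<notin> words k" for w
        using hom_module_memD(1)[OF f basis_closed[OF s]] that unfolding truncated_series_def by blast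
      show "hom_of_coeffs k p s = f s"
      proof (rule series_eqI)
        show "coeff (hom_of_coeffs k p s) w = coeff (f s) w" for w
          using fs[of w] s by (simp add: coeff_hom_of_coeffs_basis p_def p) (simp add: c_def)
      qed
    qed
    ultimately show "f \<in> hom_of_coeffs k ` carrier (free_Abelian_group ?I)"
      by (intro image_eqI[of _ _ p]) simp_all
  next
    fix f assume "f \<in> hom_of_coeffs k ` carrier (free_Abelian_group ?I)"
    then show "f \<in> carrier (hom_module k)" using mem by blast
  qed
qed

lemma finite_rank_hom_module: "finite_rank_free_abelian (hom_module k)"
proof -
  let ?I = "S \<times> words k"
  have "free_Abelian_group ?I \<cong> hom_module k" using hom_of_coeffs_iso by (auto simp: is_iso_def)
  then have "hom_module k \<cong> free_Abelian_group ?I" by (rule group.iso_sym[OF group_free_Abelian_group])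
  moreover have "?I \<approx> {..<card ?I}"
    using finite_basis finite_words by (simp add: eqpoll_iff_card)
  then have "free_Abelian_group ?I \<cong> free_Abelian_group {..<card ?I}"
    by (simp add: isomorphic_free_Abelian_groups)
  ultimately have "hom_module k \<cong> free_Abelian_group {..<card ?I}" by (rule iso_trans)
  then show ?thesis using comm_group_hom_module by (auto simp: finite_rank_free_abelian_def)
qed

definition hom_module_act :: "nat \<Rightarrow> ('a \<Rightarrow> 'a) \<Rightarrow> ('a \<Rightarrow> 'a series) \<Rightarrow> 'a \<Rightarrow> 'a series" where
  "hom_module_act k \<alpha> f = (\<lambda>u\<in>carrier G. series_act k \<alpha> (f ((inv\<^bsub>AutoGroup G\<^esub> \<alpha>) u)))"

lemma auto_hom: "\<alpha> \<in> auto G \<Longrightarrow> \<alpha> \<in> hom G G"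
  by (simp add: auto_def)

lemma hom_module_act_hom:
  assumes \<alpha>: "\<alpha> \<in> auto G"
  shows "hom_module_act k \<alpha> \<in> hom (hom_module k) (hom_module k)"
proof (rule homI)
  let ?i = "inv\<^bsub>AutoGroup G\<^esub> \<alpha>"
  note i = auto_inv(1)[OF \<alpha>]
  fix f assume f: "f \<in> carrier (hom_module k)"
  show "hom_module_act k \<alpha> f \<in> carrier (hom_module k)"
    unfolding hom_module_act_def
    by (rule hom_module_memI)
       (simp_all add: auto_mult[OF i] auto_closed[OF i] hom_module_memD[OF f] series_act_add
          series_act_closed[OF auto_hom[OF \<alpha>]])
  fix g assume g: "g \<in> carrier (hom_module k)"
  show "hom_module_act k \<alpha> (f \<otimes>\<^bsub>hom_module k\<^esub> g) = hom_module_act k \<alpha> f \<otimes>\<^bsub>hom_module k\<^esub> hom_module_act k \<alpha> g"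
    by (auto simp: hom_module_act_def hom_module_def auto_closed[OF i] series_act_add)
qed

lemma hom_module_act_mult:
  assumes \<alpha>: "\<alpha> \<in> auto G" and \<beta>: "\<beta> \<in> auto G" and f: "f \<in> carrier (hom_module k)"
  shows "hom_module_act k (\<alpha> \<otimes>\<^bsub>AutoGroup G\<^esub> \<beta>) f = hom_module_act k \<alpha> (hom_module_act k \<beta> f)"
proof -
  interpret A: group "AutoGroup G" by (rule AutoGroup)
  note i = auto_inv(1)[OF \<alpha>] auto_inv(1)[OF \<beta>]
  have ab: "\<alpha> \<otimes>\<^bsub>AutoGroup G\<^esub> \<beta> \<in> auto G"
    using A.m_closed[of \<alpha> \<beta>] \<alpha> \<beta> by (simp add: carrier_AutoGroup)
  have "(inv\<^bsub>AutoGroup G\<^esub> (\<alpha> \<otimes>\<^bsub>AutoGroup G\<^esub> \<beta>)) u = (inv\<^bsub>AutoGroup G\<^esub> \<beta>) ((inv\<^bsub>AutoGroup G\<^esub> \<alpha>) u)"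
    if "u \<in> carrier G" for u
    using A.inv_mult_group[of \<alpha> \<beta>] \<alpha> \<beta> i that by (simp add: carrier_AutoGroup mult_AutoGroup compose_def)
  moreover have "series_act k (\<alpha> \<otimes>\<^bsub>AutoGroup G\<^esub> \<beta>) x = series_act k \<alpha> (series_act k \<beta> x)"
    if "x \<in> truncated_series k" for x
    using that
    by (intro series_act_compose auto_hom \<alpha> \<beta> ab) (simp_all add: mult_AutoGroup \<alpha> \<beta> compose_def)
  ultimately show ?thesis
    by (auto simp: hom_module_act_def auto_closed i hom_module_memD[OF f])
qed

lemma hom_module_act_one:
  assumes f: "f \<in> carrier (hom_module k)"
  shows "hom_module_act k \<one>\<^bsub>AutoGroup G\<^esub> f = f"
proof -
  interpret A: group "AutoGroup G" by (rule AutoGroup)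
  have "series_act k (\<lambda>x\<in>carrier G. x) x = x" if "x \<in> truncated_series k" for x
    using that by (intro series_act_id auto_hom id_in_auto) simp_all
  then have "hom_module_act k \<one>\<^bsub>AutoGroup G\<^esub> f u = f u" for u
    using hom_module_memD[OF f]
    by (cases "u \<in> carrier G") (simp_all add: hom_module_act_def one_AutoGroup[of G, symmetric] A.inv_one, 
        simp_all add: one_AutoGroup extensional_def)
  then show ?thesis by blast
qed

section \<open>The Johnson homomorphism inside the module\<close>

text \<open>The choice of the representative of the coset is immaterial by the next lemma.\<close>

definition leading_part :: "nat \<Rightarrow> 'a set \<Rightarrow> 'a series" where
  "leading_part k X = trunc k (magnus (SOME w. w \<in> X) - 1)"

lemma leading_part_coset:
  assumes w: "w \<in> carrier G"
  shows "leading_part k (lower_central G k #> w) = trunc k (magnus w - 1)"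
proof -
  have "w \<in> lower_central G k #> w" using w by (intro rcos_self lower_central_subgroup)
  then have "(SOME x. x \<in> lower_central G k #> w) \<in> lower_central G k #> w" by (rule someI)
  then obtain n where n: "n \<in> lower_central G k" "(SOME x. x \<in> lower_central G k #> w) = n \<otimes> w"
    by (auto simp: r_coset_def)
  have nd: "n \<in> dimension_subgroup (Suc k)" using n(1) lower_central_subset_dimension_subgroup by blast
  have "(magnus (n \<otimes> w) - 1) - (magnus w - 1) = (magnus n - 1) * magnus w"
    using nd w by (simp add: dimension_subgroup_def magnus_mult algebra_simps)
  also have "\<dots> \<in> order_ideal (Suc k)"
    using nd by (intro order_ideal_mult_right) (simp add: dimension_subgroup_def)
  finally show ?thesis by (simp add: leading_part_def n(2) trunc_eq_iff)
qed

text \<open>The product of \<open>magnus x - 1\<close> and \<open>magnus y - 1\<close> starts in degree \<open>k + 1\<close> or later.\<close>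

lemma trunc_magnus_mult:
  assumes "x \<in> lower_central G (k - 1)" "y \<in> carrier G" "1 \<le> k"
  shows "trunc k (magnus (x \<otimes> y) - 1) = trunc k (magnus x - 1) + trunc k (magnus y - 1)"
proof -
  have "x \<in> dimension_subgroup k" "y \<in> dimension_subgroup 1"
    using assms lower_central_subset_dimension_subgroup[of "k - 1"] magnus_minus_one
    by (auto simp: dimension_subgroup_def)
  from magnus_mult_mod[OF this] show ?thesis
    by (simp add: trunc_eq_iff flip: trunc_add)
qed

lemma carrier_johnson_target:
  "f \<in> carrier (johnson_target G k) \<longleftrightarrow>
    f \<in> hom (abelianization G) (lower_central_quotient G (k + 1)) \<and> f \<in> extensional (carrier (abelianization G))"
  by (simp add: johnson_target_def hom_group_def)

lemma carrier_abelianization: "carrier (abelianization G) = (\<lambda>u. derived G (carrier G) #> u) ` carrier G"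
  by (auto simp: abelianization_def FactGroup_def RCOSETS_def)

lemma carrier_lower_central_quotient:
  "carrier (lower_central_quotient G (k + 1)) = (\<lambda>w. lower_central G k #> w) ` lower_central G (k - 1)"
  by (auto simp: lower_central_quotient_def FactGroup_def RCOSETS_def r_coset_def)

lemma mult_lower_central_quotient: "X \<otimes>\<^bsub>lower_central_quotient G m\<^esub> Y = X <#> Y"
  and mult_abelianization: "X \<otimes>\<^bsub>abelianization G\<^esub> Y = X <#> Y"
  by (simp_all add: lower_central_quotient_def abelianization_def set_mult_def)

lemma johnson_target_value:
  assumes f: "f \<in> carrier (johnson_target G k)" and u: "u \<in> carrier G"
  obtains w where "w \<in> lower_central G (k - 1)" "f (derived G (carrier G) #> u) = lower_central G k #> w"
proof -
  have "f (derived G (carrier G) #> u) \<in> carrier (lower_central_quotient G (k + 1))"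
    using f u unfolding carrier_johnson_target by (intro hom_in_carrier[of f "abelianization G"]) (auto simp: carrier_abelianization)
  then show ?thesis using that unfolding carrier_lower_central_quotient by blast
qed

lemma johnson_target_mult:
  assumes f: "f \<in> carrier (johnson_target G k)" and uv: "u \<in> carrier G" "v \<in> carrier G"
  shows "f (derived G (carrier G) #> (u \<otimes> v))
    = f (derived G (carrier G) #> u) <#> f (derived G (carrier G) #> v)"
proof -
  interpret D: normal "derived G (carrier G)" G by (rule derived_self_is_normal)
  have "f ((derived G (carrier G) #> u) \<otimes>\<^bsub>abelianization G\<^esub> (derived G (carrier G) #> v))
    = f (derived G (carrier G) #> u) \<otimes>\<^bsub>lower_central_quotient G (k + 1)\<^esub> f (derived G (carrier G) #> v)"
    using f uv by (intro hom_mult[of f "abelianization G"]) (auto simp: carrier_johnson_target carrier_abelianization)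
  then show ?thesis
    using uv by (simp add: mult_abelianization mult_lower_central_quotient D.rcos_sum)
qed

lemma coset_prod:
  assumes "x \<in> lower_central G j" "y \<in> lower_central G j"
  shows "(lower_central G k #> x) <#> (lower_central G k #> y) = lower_central G k #> (x \<otimes> y)"
  using assms lower_central_carrier by (intro normal.rcos_sum[OF lower_central_normal]) auto

lemma leading_part_mult:
  assumes "1 \<le> k" "x \<in> lower_central G (k - 1)" "y \<in> lower_central G (k - 1)"
  shows "leading_part k ((lower_central G k #> x) <#> (lower_central G k #> y))
    = leading_part k (lower_central G k #> x) + leading_part k (lower_central G k #> y)"
  using assms lower_central_carrier
  by (simp add: coset_prod leading_part_coset trunc_magnus_mult)

definition johnson_embedding :: "nat \<Rightarrow> ('a set \<Rightarrow> 'a set) \<Rightarrow> 'a \<Rightarrow> 'a series" where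
  "johnson_embedding k f = (\<lambda>u\<in>carrier G. leading_part k (f (derived G (carrier G) #> u)))"

lemma johnson_embedding_hom:
  assumes k: "1 \<le> k"
  shows "johnson_embedding k \<in> hom (johnson_target G k) (hom_module k)"
proof (rule homI)
  let ?D = "derived G (carrier G)"
  fix f assume f: "f \<in> carrier (johnson_target G k)"
  show "johnson_embedding k f \<in> carrier (hom_module k)"
    unfolding johnson_embedding_def
  proof (rule hom_module_memI)
    fix u assume u: "u \<in> carrier G"
    obtain w where w: "w \<in> lower_central G (k - 1)" "f (?D #> u) = lower_central G k #> w"
      using johnson_target_value[OF f u] .
    have "leading_part k (f (?D #> u)) = trunc k (magnus w) - trunc k (magnus \<one>)"
      using lower_central_carrier[OF w(1)] by (simp add: w(2) leading_part_coset magnus_one trunc_diff)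
    also have "\<dots> \<in> truncated_series k"
      using lower_central_carrier[OF w(1)] by (intro truncated_series_diff trunc_magnus_mem) auto
    finally show "leading_part k (f (?D #> u)) \<in> truncated_series k" .
    fix v assume v: "v \<in> carrier G"
    obtain w' where w': "w' \<in> lower_central G (k - 1)" "f (?D #> v) = lower_central G k #> w'"
      using johnson_target_value[OF f v] .
    show "leading_part k (f (?D #> (u \<otimes> v))) = leading_part k (f (?D #> u)) + leading_part k (f (?D #> v))"
      using w w' k by (simp add: johnson_target_mult[OF f u v] leading_part_mult)
  qed
  fix g assume g: "g \<in> carrier (johnson_target G k)"
  show "johnson_embedding k (f \<otimes>\<^bsub>johnson_target G k\<^esub> g)
    = johnson_embedding k f \<otimes>\<^bsub>hom_module k\<^esub> johnson_embedding k g"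
  proof
    fix u
    show "johnson_embedding k (f \<otimes>\<^bsub>johnson_target G k\<^esub> g) u
      = (johnson_embedding k f \<otimes>\<^bsub>hom_module k\<^esub> johnson_embedding k g) u"
    proof (cases "u \<in> carrier G")
      case True
      obtain w where w: "w \<in> lower_central G (k - 1)" "f (?D #> u) = lower_central G k #> w"
        using johnson_target_value[OF f True] .
      obtain w' where w': "w' \<in> lower_central G (k - 1)" "g (?D #> u) = lower_central G k #> w'"
        using johnson_target_value[OF g True] .
      have "(f \<otimes>\<^bsub>johnson_target G k\<^esub> g) (?D #> u) = f (?D #> u) <#> g (?D #> u)"
        using True by (simp add: johnson_target_def hom_group_def carrier_abelianization
            mult_lower_central_quotient)
      then show ?thesis
        using True w w' k by (simp add: johnson_embedding_def hom_module_mult leading_part_mult)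
    qed (simp add: johnson_embedding_def hom_module_def)
  qed
qed

text \<open>If two cosets have equal leading parts, the quotient of their representatives has no part
  of degree \<open>k\<close>, and the theorem of Magnus and Witt puts it into the next term of the lower
  central series.\<close>

lemma johnson_embedding_inj:
  assumes k: "1 \<le> k"
  shows "inj_on (johnson_embedding k) (carrier (johnson_target G k))"
proof (rule inj_onI)
  let ?D = "derived G (carrier G)"
  fix f g assume f: "f \<in> carrier (johnson_target G k)" and g: "g \<in> carrier (johnson_target G k)"
    and eq: "johnson_embedding k f = johnson_embedding k g"
  show "f = g"
  proof (rule extensionalityI[of f "carrier (abelianization G)"])
    show "f \<in> extensional (carrier (abelianization G))" "g \<in> extensional (carrier (abelianization G))"
      using f g by (simp_all add: carrier_johnson_target)
    fix c assume "c \<in> carrier (abelianization G)"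
    then obtain u where u: "u \<in> carrier G" "c = ?D #> u" by (auto simp: carrier_abelianization)
    obtain w where w: "w \<in> lower_central G (k - 1)" "f (?D #> u) = lower_central G k #> w"
      using johnson_target_value[OF f u(1)] .
    obtain w' where w': "w' \<in> lower_central G (k - 1)" "g (?D #> u) = lower_central G k #> w'"
      using johnson_target_value[OF g u(1)] .
    have wc: "w \<in> carrier G" "w' \<in> carrier G" using w w' lower_central_carrier by auto
    let ?d = "w \<otimes> inv w'"
    have d: "?d \<in> lower_central G (k - 1)"
      using w w' by (intro subgroup.m_closed subgroup.m_inv_closed lower_central_subgroup)
    have "trunc k (magnus w - 1) = trunc k (magnus w' - 1)"
      using fun_cong[OF eq, of u] u(1) w w' wc by (simp add: johnson_embedding_def leading_part_coset)
    moreover have "trunc k (magnus (?d \<otimes> w') - 1) = trunc k (magnus ?d - 1) + trunc k (magnus w' - 1)"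
      by (rule trunc_magnus_mult[OF d wc(2) k])
    moreover have "?d \<otimes> w' = w" using wc by (simp add: m_assoc)
    ultimately have "trunc k (magnus ?d - 1) = trunc k 0" by (simp add: trunc_zero)
    then have "?d \<in> dimension_subgroup (Suc k)" using wc by (simp add: trunc_eq_iff dimension_subgroup_def)
    then have "?d \<in> lower_central G k" using magnus_dimension_subgroup[OF d] k by simp
    then have "w \<in> lower_central G k #> w'"
      using wc by (simp add: subgroup.rcos_module[OF lower_central_subgroup is_group])
    then show "f c = g c"
      using u(2) w(2) w'(2) wc repr_independence[OF _ wc(2) lower_central_subgroup] by metis
  qed
qed

lemma johnson_embedding_equivariant:
  assumes \<alpha>: "\<alpha> \<in> auto G" and f: "f \<in> carrier (johnson_target G k)" and k: "1 \<le> k"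
  shows "johnson_embedding k (johnson_target_act G k \<alpha> f) = hom_module_act k \<alpha> (johnson_embedding k f)"
proof
  fix u
  let ?D = "derived G (carrier G)" and ?i = "inv\<^bsub>AutoGroup G\<^esub> \<alpha>"
  show "johnson_embedding k (johnson_target_act G k \<alpha> f) u = hom_module_act k \<alpha> (johnson_embedding k f) u"
  proof (cases "u \<in> carrier G")
    case True
    note i = auto_inv(1)[OF \<alpha>]
    have iu: "?i u \<in> carrier G" using True by (rule auto_closed[OF i])
    obtain w where w: "w \<in> lower_central G (k - 1)" "f (?D #> ?i u) = lower_central G k #> w"
      using johnson_target_value[OF f iu] .
    have wc: "w \<in> carrier G" "\<alpha> w \<in> carrier G" using lower_central_carrier[OF w(1)] auto_closed[OF \<alpha>] by auto
    have "johnson_target_act G k \<alpha> f (?D #> u)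
      = coset_act (lower_central_quotient G (k + 1)) \<alpha> (f (coset_act (abelianization G) ?i (?D #> u)))"
      using True by (simp add: johnson_target_act_def carrier_abelianization)
    also have "\<dots> = lower_central G k #> \<alpha> w"
      using coset_act_lower_central_quotient[OF \<alpha>, of w "k + 1"] w
      by (simp add: coset_act_abelianization[OF i True])
    finally have "johnson_embedding k (johnson_target_act G k \<alpha> f) u = trunc k (magnus (\<alpha> w) - 1)"
      using True wc by (simp add: johnson_embedding_def leading_part_coset)
    also have "\<dots> = series_act k \<alpha> (trunc k (magnus w - 1))"
      using wc by (simp add: series_act_trunc series_act_diff series_act_magnus series_act_one trunc_diff auto_hom[OF \<alpha>])
    finally show ?thesis
      using True iu wc w by (simp add: hom_module_act_def johnson_embedding_def leading_part_coset)
  qed (simp add: johnson_embedding_def hom_module_act_def)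
qed

text \<open>The homomorphism which takes \<open>s\<close> to its variable, i.e. a linear section of the projection from the
  series without constant term to the abelianization.\<close>

definition linear_section :: "'a \<Rightarrow> 'a series" where
  "linear_section = (\<lambda>u\<in>carrier G. Series (\<lambda>w. if length w = 1 then coeff (magnus u) w else 0))"

lemma linear_section_mem: "1 \<le> k \<Longrightarrow> linear_section \<in> carrier (hom_module k)"
  unfolding linear_section_def
proof (rule hom_module_memI)
  fix u assume u: "u \<in> carrier G" and k: "1 \<le> k"
  show "Series (\<lambda>w. if length w = 1 then coeff (magnus u) w else 0) \<in> truncated_series k"
    using coeff_magnus_support[OF u] k by (auto simp: truncated_series_def words_def split: if_splits)
next
  fix u v assume uv: "u \<in> carrier G" "v \<in> carrier G"
  show "Series (\<lambda>w. if length w = 1 then coeff (magnus (u \<otimes> v)) w else 0)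
    = Series (\<lambda>w. if length w = 1 then coeff (magnus u) w else 0)
      + Series (\<lambda>w. if length w = 1 then coeff (magnus v) w else 0)"
    by (rule series_eqI) (auto simp: length_Suc_conv exponent_add[OF uv])
qed

lemma linear_section_basis: "s \<in> S \<Longrightarrow> linear_section s = series_var s"
  by (rule series_eqI) (auto simp: linear_section_def basis_closed magnus_basis coeff_one coeff_var length_Suc_conv)

lemma linear_section_lower_central: "u \<in> lower_central G 1 \<Longrightarrow> linear_section u = 0"
proof (rule series_eqI)
  fix w assume "u \<in> lower_central G 1"
  then have u: "u \<in> carrier G" "u \<in> dimension_subgroup (Suc 1)"
    using lower_central_subset_dimension_subgroup[of 1] lower_central_carrier by auto
  then have "coeff (magnus u - 1) w = 0" if "length w = 1"
    using that unfolding dimension_subgroup_def order_ideal_def by auto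
  then show "coeff (linear_section u) w = coeff 0 w"
    using u by (auto simp: linear_section_def coeff_one)
qed

text \<open>Two homomorphisms are compared on the basis. As \<open>\<alpha>\<close> acts trivially on the
  abelianization, the action on \<open>linear_section\<close> reduces to substitution in the variable of
  \<open>s\<close>, which gives \<open>magnus (\<alpha> s) - 1\<close> up to degree \<open>k\<close>. This differs from the variable by the leading
  part of \<open>\<alpha> s \<otimes> inv s\<close>. The bound \<open>2 \<le> k\<close> enters since for \<open>k = 1\<close> the automorphism need not fix the
  abelianization.\<close>

lemma act_linear_section:
  assumes \<alpha>: "\<alpha> \<in> andreadakis G k" and k: "2 \<le> k"
  shows "hom_module_act k \<alpha> linear_section = johnson_embedding k (johnson G k \<alpha>) \<otimes>\<^bsub>hom_module k\<^esub> linear_section"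
proof (rule hom_module_eqI[of _ k])
  have aut: "\<alpha> \<in> auto G" and small: "\<And>u. u \<in> carrier G \<Longrightarrow> \<alpha> u \<otimes> inv u \<in> lower_central G (k - 1)"
    using \<alpha> by (auto simp: andreadakis_iff)
  have k1: "1 \<le> k" using k by simp
  interpret B: comm_group "hom_module k" by (rule comm_group_hom_module)
  note sec = linear_section_mem[OF k1]
  show "hom_module_act k \<alpha> linear_section \<in> carrier (hom_module k)"
    using hom_in_carrier[OF hom_module_act_hom[OF aut] sec] .
  show "johnson_embedding k (johnson G k \<alpha>) \<otimes>\<^bsub>hom_module k\<^esub> linear_section \<in> carrier (hom_module k)"
    using hom_in_carrier[OF johnson_embedding_hom[OF k1] johnson_in_target[OF \<alpha> k1]] sec by (rule B.m_closed)
  fix s assume s: "s \<in> S"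
  let ?v = "(inv\<^bsub>AutoGroup G\<^esub> \<alpha>) s"
  have c: "s \<in> carrier G" "?v \<in> carrier G" "\<alpha> s \<in> carrier G"
    using s basis_closed auto_closed[OF auto_inv(1)[OF aut]] auto_closed[OF aut] by auto
  have "\<alpha> ?v \<otimes> inv ?v \<in> lower_central G 1"
    using subsetD[OF lower_central_antimono[of 1 "k - 1"] small[OF c(2)]] k by simp
  then have "linear_section (s \<otimes> inv ?v) = 0"
    using linear_section_lower_central auto_inv(2)[OF aut c(1)] by simp
  moreover have "s = (s \<otimes> inv ?v) \<otimes> ?v" using c by (simp add: m_assoc)
  then have "linear_section s = linear_section (s \<otimes> inv ?v) + linear_section ?v"
    using hom_module_memD(2)[OF sec, of "s \<otimes> inv ?v" ?v] c by simp
  ultimately have "linear_section ?v = magnus s - magnus \<one>"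
    using linear_section_basis[OF s] by (simp add: magnus_basis[OF s] magnus_one)
  then have "hom_module_act k \<alpha> linear_section s = trunc k (magnus (\<alpha> s) - 1)"
    using c by (simp add: hom_module_act_def series_act_diff series_act_magnus series_act_one
        magnus_one trunc_diff auto_hom[OF aut])
  also have "\<dots> = trunc k (magnus (\<alpha> s \<otimes> inv s) - 1) + trunc k (magnus s - 1)"
    using trunc_magnus_mult[OF small[OF c(1)] c(1) k1] c by (simp add: m_assoc)
  also have "trunc k (magnus s - 1) = series_var s"
    using k1 by (intro series_eqI) (simp add: magnus_basis[OF s] coeff_trunc coeff_var)
  finally show "hom_module_act k \<alpha> linear_section s
    = (johnson_embedding k (johnson G k \<alpha>) \<otimes>\<^bsub>hom_module k\<^esub> linear_section) s"
    using c by (simp add: hom_module_mult johnson_embedding_def johnson_coset[OF \<alpha> k1] leading_part_coset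
        linear_section_basis[OF s])
qed

end

theorem corollary1p2:
  fixes \<pi> :: "'a monoid" and n k :: nat
  assumes "free_group_of_rank \<pi> n"
    and "\<not> comm_group \<pi>"
    and "k \<ge> 2"
  shows "\<exists>(A :: (nat \<Rightarrow>\<^sub>0 int) monoid) \<phi> \<eta> \<gamma>.
    finite_rank_free_abelian A \<and>
    module_action (AutoGroup \<pi>) A \<phi> \<and>
    \<eta> \<in> hom (johnson_target \<pi> k) A \<and>
    inj_on \<eta> (carrier (johnson_target \<pi> k)) \<and>
    (\<forall>\<alpha>\<in>carrier (AutoGroup \<pi>). \<forall>f\<in>carrier (johnson_target \<pi> k).
      \<eta> (johnson_target_act \<pi> k \<alpha> f) = \<phi> \<alpha> (\<eta> f)) \<and>
    crossed_hom (AutoGroup \<pi>) A \<phi> \<gamma> \<and>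
    (\<forall>\<alpha>\<in>andreadakis \<pi> k. \<gamma> \<alpha> = \<eta> (johnson \<pi> k \<alpha>))"
proof -
  from assms(1) obtain S where S: "free_basis \<pi> S" "finite S"
    by (auto simp: free_group_of_rank_def)
  interpret free_group_on_basis \<pi> S
    using S by (intro free_group_on_basis.intro free_group_on_basis_axioms.intro) (auto simp: free_basis_def)
  have k: "1 \<le> k" using assms(3) by simp
  interpret B: comm_group "hom_module k" by (rule comm_group_hom_module)
  obtain A :: "(nat \<Rightarrow>\<^sub>0 int) monoid" and \<phi> h where A: "finite_rank_free_abelian A"
    and \<phi>: "module_action (AutoGroup \<pi>) A \<phi>" and h: "h \<in> iso (hom_module k) A"
    and equiv: "\<And>\<alpha> x. \<alpha> \<in> carrier (AutoGroup \<pi>) \<Longrightarrow> x \<in> carrier (hom_module k) \<Longrightarrow>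
      \<phi> \<alpha> (h x) = h (hom_module_act k \<alpha> x)"
    by (rule lattice_transport[OF AutoGroup finite_rank_hom_module[of k], of "hom_module_act k"])
       (auto simp: carrier_AutoGroup hom_module_act_hom hom_module_act_mult hom_module_act_one)
  interpret A: comm_group A using A by (simp add: finite_rank_free_abelian_def)
  have hom: "h \<in> hom (hom_module k) A" and inj: "inj_on h (carrier (hom_module k))"
    using h by (auto simp: iso_def bij_betw_def)
  let ?\<eta> = "\<lambda>f. h (johnson_embedding k f)"
  let ?s = "h linear_section"
  let ?\<gamma> = "\<lambda>\<alpha>. \<phi> \<alpha> ?s \<otimes>\<^bsub>A\<^esub> inv\<^bsub>A\<^esub> ?s"
  note emb = hom_in_carrier[OF johnson_embedding_hom[OF k]]
  note sec = linear_section_mem[OF k]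
  have 1: "?\<eta> \<in> hom (johnson_target \<pi> k) A"
    using Group.hom_compose[OF johnson_embedding_hom[OF k] hom] by (simp add: o_def)
  have 2: "inj_on ?\<eta> (carrier (johnson_target \<pi> k))"
    using johnson_embedding_inj[OF k] inj emb by (auto simp: inj_on_def)
  have 3: "?\<eta> (johnson_target_act \<pi> k \<alpha> f) = \<phi> \<alpha> (?\<eta> f)"
    if "\<alpha> \<in> carrier (AutoGroup \<pi>)" "f \<in> carrier (johnson_target \<pi> k)" for \<alpha> f
    using equiv[OF that(1) emb[OF that(2)]] johnson_embedding_equivariant[OF _ that(2) k] that(1)
    by (simp add: carrier_AutoGroup)
  have 4: "crossed_hom (AutoGroup \<pi>) A \<phi> ?\<gamma>"
    using hom_in_carrier[OF hom sec] by (intro principal_crossed_hom AutoGroup A.comm_group_axioms \<phi>)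
  have 5: "?\<gamma> \<alpha> = ?\<eta> (johnson \<pi> k \<alpha>)" if \<alpha>: "\<alpha> \<in> andreadakis \<pi> k" for \<alpha>
  proof -
    have aut: "\<alpha> \<in> carrier (AutoGroup \<pi>)" using \<alpha> by (simp add: andreadakis_iff carrier_AutoGroup)
    have j: "johnson_embedding k (johnson \<pi> k \<alpha>) \<in> carrier (hom_module k)"
      by (rule emb[OF johnson_in_target[OF \<alpha> k]])
    have "\<phi> \<alpha> ?s = ?\<eta> (johnson \<pi> k \<alpha>) \<otimes>\<^bsub>A\<^esub> ?s"
      using equiv[OF aut sec] act_linear_section[OF \<alpha> assms(3)] hom_mult[OF hom j sec] by simp
    then show ?thesis
      using hom_in_carrier[OF hom j] hom_in_carrier[OF hom sec] by (simp add: A.m_assoc)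
  qed
  show ?thesis
    using A \<phi> 1 2 3 4 5 by blast
qed

end
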